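(* Let $\Delta\in\mathbb{N}$ and let $w\in\mathbb{C}$. Then there exists a constant $K$ (depending on $\Delta$ and $w$) such that if $q\in\mathbb{C}$ is such that $|q|>K$, then there exists a deterministic algorithm which, given a loopless multigraph $G=(V,E)$ of maximum degree at most $\Delta$ and $\varepsilon>0$, computes a multiplicative $\varepsilon$-approximation to $Z_T(G)(q,w)$ in time $(|V|/\varepsilon)^{O(1)}$.
   Context: For a (multi)graph $G=(V,E)$, the random cluster formulation of the Tutte polynomial is $Z_T(G)(q,w):=\sum_{A\subseteq E}q^{k(A)}w^{|A|}$, where $k(A)$ denotes the number of connected components of the graph $(V,A)$. The degree of a vertex in a multigraph is the number of edges incident with it. For non-zero complex numbers $x,\xi$, $\xi$ is called a multiplicative $\varepsilon$-approximation to $x$ if $e^{-\varepsilon}\le |x|/|\xi|\le e^{\varepsilon}$ and the angle between $\xi$ and $x$ (as vectors in $\mathbb{C}=\mathbb{R}^2$) is at most $\varepsilon$. The running time is an asymptotic bound; the constant implicit in the exponent $O(1)$ may depend on the fixed data $\Delta$, $w$ and $q$, but not on $G$ or $\varepsilon$.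
   Formalization: The time bound is C(max(1,|V|)/min(1,ε))^C in a unit-cost model with exact complex arithmetic: for ε>1 the time for ε=1 is allowed, and the empty graph counts as |V|=1, since the literal bound (|V|/ε)^{O(1)} can fall below one step there. *)

theory Defs
  imports "HOL-Analysis.Analysis"
begin

section \<open>Multigraphs and the random cluster polynomial\<close>

text \<open>Edges are abstract objects, so parallel edges are distinct edges with the same set of ends.\<close>

record ('v, 'e) multigraph =
  verts :: "'v set"
  edges :: "'e set"
  ends :: "'e \<Rightarrow> 'v set"

definition loopless_multigraph :: "('v, 'e) multigraph \<Rightarrow> bool" where
  "loopless_multigraph G \<longleftrightarrow>
     finite (verts G) \<and> finite (edges G) \<and>
     (\<forall>e\<in>edges G. ends G e \<subseteq> verts G \<and> card (ends G e) = 2)"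

definition vertex_degree :: "('v, 'e) multigraph \<Rightarrow> 'v \<Rightarrow> nat" where
  "vertex_degree G v = card {e \<in> edges G. v \<in> ends G e}"

definition adjacent_via :: "('v, 'e) multigraph \<Rightarrow> 'e set \<Rightarrow> ('v \<times> 'v) set" where
  "adjacent_via G A = {(u, v). \<exists>e\<in>A. ends G e = {u, v}}"

definition connected_via :: "('v, 'e) multigraph \<Rightarrow> 'e set \<Rightarrow> ('v \<times> 'v) set" where
  "connected_via G A = {(u, v). u \<in> verts G \<and> v \<in> verts G \<and> (u, v) \<in> (adjacent_via G A)\<^sup>*}"

definition num_components :: "('v, 'e) multigraph \<Rightarrow> 'e set \<Rightarrow> nat" where
  "num_components G A = card (verts G // connected_via G A)"

definition Z_T :: "('v, 'e) multigraph \<Rightarrow> complex \<Rightarrow> complex \<Rightarrow> complex" where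
  "Z_T G q w = (\<Sum>A\<in>Pow (edges G). q ^ num_components G A * w ^ card A)"


section \<open>Multiplicative approximation\<close>

definition angle_between :: "complex \<Rightarrow> complex \<Rightarrow> real" where
  "angle_between x y = arccos ((x \<bullet> y) / (norm x * norm y))"

definition mult_approx :: "real \<Rightarrow> complex \<Rightarrow> complex \<Rightarrow> bool" where
  "mult_approx \<epsilon> \<xi> x \<longleftrightarrow>
     x \<noteq> 0 \<and> \<xi> \<noteq> 0 \<and>
     exp (- \<epsilon>) \<le> cmod x / cmod \<xi> \<and> cmod x / cmod \<xi> \<le> exp \<epsilon> \<and>
     angle_between \<xi> x \<le> \<epsilon>"


section \<open>Deterministic algorithms\<close>

text \<open>
  Since \<open>q\<close> and \<open>w\<close> are arbitrary complex numbers, running time is counted in a unit-cost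
  random access model with exact complex arithmetic (real RAM): finitely many registers
  and unbounded arrays over the natural and over the complex numbers, used by a structured
  program. The naturals only have addition and truncated subtraction, so that they stay of
  bit length linear in the running time, and there is no rounding of complex numbers to
  naturals; unit-cost multiplication, division or rounding of integers would make the model
  unrealistically powerful. Literals are natural numbers and the imaginary unit, so a program
  cannot contain arbitrary real constants. Division by zero yields zero.
\<close>

record state =
  nreg :: "nat \<Rightarrow> nat"
  creg :: "nat \<Rightarrow> complex"
  narr :: "nat \<Rightarrow> nat \<Rightarrow> nat"
  carr :: "nat \<Rightarrow> nat \<Rightarrow> complex"

datatype nexp =
    NLit nat
  | NReg nat
  | NArr nat nexp
  | NPlus nexp nexp
  | NMinus nexp nexp

datatype cexp =
    COfNat nexp
  | CImagUnit
  | CReg nat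
  | CArr nat nexp
  | CPlus cexp cexp
  | CMinus cexp cexp
  | CTimes cexp cexp
  | CDivide cexp cexp
  | CRe cexp
  | CIm cexp

datatype test =
    NLess nexp nexp
  | ReLess cexp cexp
  | TNot test
  | TAnd test test

datatype com =
    Skip
  | NAssign nat nexp
  | NStore nat nexp nexp
  | CAssign nat cexp
  | CStore nat nexp cexp
  | Seq com com
  | Cond test com com
  | While test com

primrec nval :: "nexp \<Rightarrow> state \<Rightarrow> nat" where
  "nval (NLit k) s = k"
| "nval (NReg x) s = nreg s x"
| "nval (NArr a e) s = narr s a (nval e s)"
| "nval (NPlus e f) s = nval e s + nval f s"
| "nval (NMinus e f) s = nval e s - nval f s"

primrec cval :: "cexp \<Rightarrow> state \<Rightarrow> complex" where
  "cval (COfNat e) s = of_nat (nval e s)"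
| "cval CImagUnit s = \<i>"
| "cval (CReg x) s = creg s x"
| "cval (CArr a e) s = carr s a (nval e s)"
| "cval (CPlus e f) s = cval e s + cval f s"
| "cval (CMinus e f) s = cval e s - cval f s"
| "cval (CTimes e f) s = cval e s * cval f s"
| "cval (CDivide e f) s = cval e s / cval f s"
| "cval (CRe e) s = of_real (Re (cval e s))"
| "cval (CIm e) s = of_real (Im (cval e s))"

primrec holds :: "test \<Rightarrow> state \<Rightarrow> bool" where
  "holds (NLess e f) s \<longleftrightarrow> nval e s < nval f s"
| "holds (ReLess e f) s \<longleftrightarrow> Re (cval e s) < Re (cval f s)"
| "holds (TNot b) s \<longleftrightarrow> \<not> holds b s"
| "holds (TAnd b c) s \<longleftrightarrow> holds b s \<and> holds c s"

text \<open>
  \<open>exec c s t s'\<close>: program \<open>c\<close> started in \<open>s\<close> halts in \<open>s'\<close> after \<open>t\<close> steps. Every assignment and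
  every evaluation of a test is one step; its expressions are part of the program text, so
  this differs from counting single operations by at most a constant factor depending on
  the program.
\<close>

inductive exec :: "com \<Rightarrow> state \<Rightarrow> nat \<Rightarrow> state \<Rightarrow> bool" where
  Skip: "exec Skip s 1 s"
| NAssign: "exec (NAssign x e) s 1 (s\<lparr>nreg := (nreg s)(x := nval e s)\<rparr>)"
| NStore: "exec (NStore a i e) s 1
    (s\<lparr>narr := (narr s)(a := (narr s a)(nval i s := nval e s))\<rparr>)"
| CAssign: "exec (CAssign x e) s 1 (s\<lparr>creg := (creg s)(x := cval e s)\<rparr>)"
| CStore: "exec (CStore a i e) s 1
    (s\<lparr>carr := (carr s)(a := (carr s a)(nval i s := cval e s))\<rparr>)"
| Seq: "exec c s t s' \<Longrightarrow> exec d s' u s'' \<Longrightarrow> exec (Seq c d) s (t + u) s''"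
| CondT: "holds b s \<Longrightarrow> exec c s t s' \<Longrightarrow> exec (Cond b c d) s (1 + t) s'"
| CondF: "\<not> holds b s \<Longrightarrow> exec d s t s' \<Longrightarrow> exec (Cond b c d) s (1 + t) s'"
| WhileF: "\<not> holds b s \<Longrightarrow> exec (While b c) s 1 s"
| WhileT: "holds b s \<Longrightarrow> exec c s t s' \<Longrightarrow> exec (While b c) s' u s'' \<Longrightarrow>
    exec (While b c) s (1 + t + u) s''"

lemma exec_deterministic:
  "exec c s t s' \<Longrightarrow> exec c s u s'' \<Longrightarrow> u = t \<and> s'' = s'"
proof (induction arbitrary: u s'' rule: exec.induct)
  case Seq
  from Seq.prems show ?case by cases (use Seq.IH in blast)
next
  case CondT
  from CondT.prems show ?case by cases (use CondT in blast)+
next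
  case CondF
  from CondF.prems show ?case by cases (use CondF in blast)+
next
  case WhileF
  from WhileF.prems show ?case by cases (use WhileF in blast)+
next
  case WhileT
  from WhileT.prems show ?case by cases (use WhileT in blast)+
qed (auto elim: exec.cases)


section \<open>Input and output\<close>

text \<open>
  A graph is handed to a program as the number \<open>n\<close> of its vertices and a list \<open>es\<close> of pairs of
  vertex numbers below \<open>n\<close>, for some numbering of the vertices and of the edges.
\<close>

definition presents :: "nat \<Rightarrow> (nat \<times> nat) list \<Rightarrow> ('v, 'e) multigraph \<Rightarrow> bool" where
  "presents n es G \<longleftrightarrow>
     (\<exists>f g. bij_betw f {..<n} (verts G) \<and> bij_betw g {..<length es} (edges G) \<and>
        (\<forall>i<length es. fst (es ! i) < n \<and> snd (es ! i) < n \<and>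
           ends G (g i) = {f (fst (es ! i)), f (snd (es ! i))}))"

text \<open>The parameters \<open>q\<close> and \<open>w\<close> are fixed data, available to a program in two registers.\<close>

definition input_state ::
  "complex \<Rightarrow> complex \<Rightarrow> nat \<Rightarrow> (nat \<times> nat) list \<Rightarrow> real \<Rightarrow> state" where
  "input_state q w n es \<epsilon> =
     \<lparr>nreg = (\<lambda>_. 0)(0 := n, 1 := length es),
      creg = (\<lambda>_. 0)(0 := of_real \<epsilon>, 1 := q, 2 := w),
      narr = (\<lambda>_ _. 0)(0 := (\<lambda>i. if i < length es then fst (es ! i) else 0),
                       1 := (\<lambda>i. if i < length es then snd (es ! i) else 0)),
      carr = (\<lambda>_ _. 0)\<rparr>"

definition final_value :: "state \<Rightarrow> complex" where
  "final_value s = creg s 0"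

text \<open>
  The base of the bound \<open>(|V| / \<epsilon>)\<^bsup>O(1)\<^esup>\<close>. The quotient only makes sense as a bound on a running
  time for \<open>\<epsilon> \<le> 1\<close> and nonempty graphs (otherwise it can be arbitrarily small),
  so larger \<open>\<epsilon>\<close> are allowed the time for \<open>\<epsilon> = 1\<close>, and the empty graph that for \<open>|V| = 1\<close>.
\<close>

definition size_over_eps :: "('v, 'e) multigraph \<Rightarrow> real \<Rightarrow> real" where
  "size_over_eps G \<epsilon> = max 1 (real (card (verts G))) / min 1 \<epsilon>"

end

(*
Write rho(F, S, E) for the ratio of Z_T of the graph on F \<union> S with S contracted to one vertex, and
q times Z_T of the graph induced on F. Deleting or contracting an edge e between S and u in F gives
  rho(F, S, E) = rho(F, S, E - e) + (w/q) rho(F - u, S + u, E - e) / rho(F - u, {u}, E restricted to F),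
while an edge inside S contributes a factor 1 + w, and Z_T is q^n times a product of n ratios with
singleton S. If |q| is large compared with w and Delta, induction along this recursion keeps every
ratio with singleton S within 1/2 of 1, so no denominator vanishes, and it shows that each
contraction damps errors by a factor 1/2. Replacing ratios by 1 after O(log(n/epsilon))
contractions therefore gives the required accuracy. A contraction brings at most Delta new edges
into play, so the truncated recursion tree is exponential in the number of contractions, that is,
polynomial in n/epsilon. The program unfolds all n trees breadth-first in one queue and evaluates the queue
backwards.
*)

theory Submission
  imports Defs
begin

section \<open>Components and contraction\<close>

text \<open>\<open>Z_T\<close> might vanish, so bounds cannot be derived by dividing exact values.
  The recursion is therefore studied as a relation on truncated values, whose denominators,
  truncated values with singleton \<open>S\<close>, are kept away from 0 without reference to
  \<open>Z_T\<close>. A budget exceeding the number of free vertices is never exhausted, and then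
  the value satisfies the identity of the ratio in product form; zero-freeness follows, and exact
  ratios turn out to be truncated values obeying the same bounds. Ratios with larger
  \<open>S\<close> need not be near 1; their modulus is bounded by a power of
  \<open>M = 2 + |w|\<close>, the exponent being the number of edges that meet \<open>S\<close>: the
  2 covers a branch, \<open>1 + |w|\<close> a loop. A contraction adds at most \<Delta> such edges
  to the at most \<Delta> of a singleton, whence the exponent \<open>2 * \<Delta>\<close> in the
  condition on \<open>q\<close>. The factor 12 there is the loss 4 + 8 in a quotient of two inexact
  values with denominators of modulus at least 1/2, and \<open>\<Delta> + 1\<close> keeps a
  singleton ratio near 1 over the at most \<Delta> edges at its vertex.\<close>

definition components_on :: "'v set \<Rightarrow> ('v \<times> 'v) set \<Rightarrow> nat" where
  "components_on T r = card (T // {(u, v). u \<in> T \<and> v \<in> T \<and> (u, v) \<in> r\<^sup>*})"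

lemma components_on_empty [simp]: "components_on {} r = 0"
  by (simp add: components_on_def)

lemma components_on_cong:
  "r \<subseteq> r'\<^sup>* \<Longrightarrow> r' \<subseteq> r\<^sup>* \<Longrightarrow> components_on T r = components_on T r'"
  using rtrancl_subset_rtrancl[of r r'] rtrancl_subset_rtrancl[of r' r]
  by (simp add: components_on_def)

text \<open>No single step of either relation crosses between \<open>F\<close> and \<open>S\<close>,
  so a path that starts in \<open>F\<close> stays there and uses only \<open>r\<close>.\<close>

lemma rtrancl_Un_disjoint:
  assumes "r \<subseteq> F \<times> F" "r' \<subseteq> S \<times> S" "F \<inter> S = {}"
  shows "x \<in> F \<Longrightarrow> (x, y) \<in> (r \<union> r')\<^sup>* \<longleftrightarrow> (x, y) \<in> r\<^sup>*"
    and "x \<in> F \<Longrightarrow> (x, y) \<in> r\<^sup>* \<Longrightarrow> y \<in> F"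
proof -
  show "y \<in> F" if "x \<in> F" "(x, y) \<in> r\<^sup>*" for x y
    using that(2,1) assms(1) by (induction rule: rtrancl_induct) auto
  show "(x, y) \<in> (r \<union> r')\<^sup>* \<longleftrightarrow> (x, y) \<in> r\<^sup>*" if "x \<in> F"
  proof
    assume "(x, y) \<in> (r \<union> r')\<^sup>*"
    then have "(x, y) \<in> r\<^sup>* \<and> y \<in> F"
    proof (induction rule: rtrancl_induct)
      case base
      then show ?case using that by simp
    next
      case (step y z)
      then show ?case using assms by (auto intro: rtrancl_into_rtrancl)
    qed
    then show "(x, y) \<in> r\<^sup>*" by simp
  next
    assume "(x, y) \<in> r\<^sup>*"
    then show "(x, y) \<in> (r \<union> r')\<^sup>*" using rtrancl_mono[of r "r \<union> r'"] by blast
  qed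
qed

text \<open>With no connection between \<open>F\<close> and \<open>S\<close>, the merged set
  \<open>S\<close> is one class of its own and the classes inside \<open>F\<close> are
  untouched.\<close>

lemma components_on_contracted:
  assumes "finite F" "r \<subseteq> F \<times> F" "F \<inter> S = {}" "S \<noteq> {}"
  shows "components_on (F \<union> S) (r \<union> S \<times> S) = Suc (components_on F r)"
proof -
  define R where "R = {(u, v). u \<in> F \<union> S \<and> v \<in> F \<union> S \<and> (u, v) \<in> (r \<union> S \<times> S)\<^sup>*}"
  define Q where "Q = {(u, v). u \<in> F \<and> v \<in> F \<and> (u, v) \<in> r\<^sup>*}"
  have RS: "R `` {x} = S" if "x \<in> S" for x
  proof
    show "R `` {x} \<subseteq> S"
      using rtrancl_Un_disjoint[of "S \<times> S" S r F x] assms that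
      by (auto simp: R_def Un_commute)
    show "S \<subseteq> R `` {x}" using that by (auto simp: R_def)
  qed
  have RF: "R `` {x} = Q `` {x}" if "x \<in> F" for x
    using rtrancl_Un_disjoint[of r F "S \<times> S" S x] assms that
    by (auto simp: R_def Q_def)
  have "(F \<union> S) // R = insert S (F // Q)"
    using assms(4) RS RF by (auto simp: quotient_def)
  moreover have "S \<notin> F // Q"
    using assms(3,4) by (auto simp: quotient_def Q_def)
  moreover have "finite (F // Q)"
    using assms(1) by (auto simp: quotient_def)
  ultimately show ?thesis
    unfolding components_on_def R_def[symmetric] Q_def[symmetric] by simp
qed

lemma sum_Pow_remove:
  fixes f :: "'a set \<Rightarrow> 'b::comm_monoid_add"
  assumes "finite E" "e \<in> E"
  shows "sum f (Pow E) = sum f (Pow (E - {e})) + (\<Sum>A\<in>Pow (E - {e}). f (insert e A))"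
proof -
  have "E = insert e (E - {e})" using assms by blast
  then have "Pow E = Pow (E - {e}) \<union> insert e ` Pow (E - {e})" by (metis Pow_insert)
  moreover have "inj_on (insert e) (Pow (E - {e}))" by (auto simp: inj_on_def)
  moreover have "Pow (E - {e}) \<inter> insert e ` Pow (E - {e}) = {}" by auto
  ultimately show ?thesis
    using assms by (simp add: sum.union_disjoint sum.reindex)
qed

section \<open>Deletion and contraction for the polynomial with a merged vertex set\<close>

locale bounded_degree_graph =
  fixes G :: "('v, 'e) multigraph" and \<Delta> :: nat and q w :: complex
  assumes loopless: "loopless_multigraph G"
    and degree: "v \<in> verts G \<Longrightarrow> vertex_degree G v \<le> \<Delta>"
    and q_large: "12 * (real \<Delta> + 1) * cmod w * (2 + cmod w) ^ (2 * \<Delta>) < cmod q"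
begin

abbreviation "adj \<equiv> adjacent_via G"

definition induced :: "'v set \<Rightarrow> 'e set \<Rightarrow> 'e set" where
  "induced F E = {e \<in> E. ends G e \<subseteq> F}"

lemma finite_edges: "finite (edges G)" and finite_verts: "finite (verts G)"
  and card_ends: "e \<in> edges G \<Longrightarrow> card (ends G e) = 2"
  and ends_verts: "e \<in> edges G \<Longrightarrow> ends G e \<subseteq> verts G"
  using loopless by (auto simp: loopless_multigraph_def)

lemma q_nonzero: "q \<noteq> 0"
proof -
  have "0 \<le> 12 * (real \<Delta> + 1) * cmod w * (2 + cmod w) ^ (2 * \<Delta>)"
    by (intro mult_nonneg_nonneg) auto
  then have "0 < cmod q" using q_large by (rule le_less_trans)
  then show ?thesis by simp
qed

lemma adj_insert: "ends G e = {s, u} \<Longrightarrow> adj (insert e A) = adj A \<union> {(s, u), (u, s)}"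
  unfolding adjacent_via_def by (auto simp: doubleton_eq_iff)

text \<open>The relation \<open>S \<times> S\<close> merges \<open>S\<close> into one vertex, so no quotient graph has to be formed.\<close>

definition Zc :: "'v set \<Rightarrow> 'v set \<Rightarrow> 'e set \<Rightarrow> complex" where
  "Zc F S E = (\<Sum>A\<in>Pow E. q ^ components_on (F \<union> S) (adj A \<union> S \<times> S) * w ^ card A)"

definition config :: "'v set \<Rightarrow> 'v set \<Rightarrow> 'e set \<Rightarrow> bool" where
  "config F S E \<longleftrightarrow> F \<inter> S = {} \<and> F \<union> S \<subseteq> verts G \<and> E \<subseteq> edges G \<and> (\<forall>e\<in>E. ends G e \<subseteq> F \<union> S)"

lemma config_finite: "config F S E \<Longrightarrow> finite F \<and> finite S \<and> finite E"
  unfolding config_def using finite_verts finite_edges by (meson finite_subset le_sup_iff)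

lemma config_delete: "config F S E \<Longrightarrow> config F S (E - {e})"
  and config_contract: "config F S E \<Longrightarrow> u \<in> F \<Longrightarrow> config (F - {u}) (insert u S) (E - {e})"
  and config_restrict: "config F S E \<Longrightarrow> u \<in> F \<Longrightarrow> config (F - {u}) {u} (induced F E)"
  and config_inside: "config F S E \<Longrightarrow> config F {} (induced F E)"
  by (auto simp: config_def induced_def)

lemma Z_T_eq_Zc: "Z_T G q w = Zc (verts G) {} (edges G)"
  by (simp add: Z_T_def Zc_def num_components_def components_on_def connected_via_def)

text \<open>In an edge set containing \<open>e\<close> the vertex \<open>u\<close> is already joined
  to \<open>S\<close>. Merging it into \<open>S\<close> thus adds no connection, and the two
  component counts agree term by term.\<close>

lemma Zc_delete_contract:
  assumes "finite E" "e \<in> E" "ends G e = {s, u}" "s \<in> S" "u \<in> F"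
  shows "Zc F S E = Zc F S (E - {e}) + w * Zc (F - {u}) (insert u S) (E - {e})"
proof -
  let ?S = "insert u S"
  have T: "F - {u} \<union> ?S = F \<union> S" using assms by blast
  have "q ^ components_on (F \<union> S) (adj (insert e A) \<union> S \<times> S) * w ^ card (insert e A)
      = w * (q ^ components_on (F - {u} \<union> ?S) (adj A \<union> ?S \<times> ?S) * w ^ card A)"
    if A: "A \<in> Pow (E - {e})" for A
  proof -
    let ?r = "adj (insert e A) \<union> S \<times> S" and ?r' = "adj A \<union> ?S \<times> ?S"
    have r: "?r = adj A \<union> {(s, u), (u, s)} \<union> S \<times> S"
      using adj_insert[OF assms(3)] by simp
    have "(u, v) \<in> ?r\<^sup>*" "(v, u) \<in> ?r\<^sup>*" if "v \<in> S" for v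
    proof -
      have "(u, s) \<in> ?r" "(s, v) \<in> ?r" "(v, s) \<in> ?r" "(s, u) \<in> ?r"
        using that assms(4) by (auto simp: r)
      then show "(u, v) \<in> ?r\<^sup>*" "(v, u) \<in> ?r\<^sup>*"
        by (meson converse_rtrancl_into_rtrancl r_into_rtrancl)+
    qed
    then have "{u} \<times> S \<union> S \<times> {u} \<subseteq> ?r\<^sup>*" by blast
    moreover have "?r \<subseteq> ?r\<^sup>*" by auto
    \<comment> \<open>The part \<open>Id\<close> accounts for the pair \<open>(u, u)\<close> of the
      enlarged square.\<close>
    moreover have "?r' \<subseteq> ?r \<union> ({u} \<times> S \<union> S \<times> {u}) \<union> Id" unfolding r by blast
    ultimately have "?r' \<subseteq> ?r\<^sup>*" by blast
    moreover have "?r \<subseteq> ?r'" unfolding r using assms by auto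
    then have "?r \<subseteq> ?r'\<^sup>*" by (rule order_trans) auto
    ultimately have "components_on (F \<union> S) ?r = components_on (F \<union> S) ?r'"
      by (rule components_on_cong[rotated])
    moreover have "card (insert e A) = Suc (card A)"
      using A assms(1) by (metis DiffE PowD Pow_iff card_insert_disjoint finite_Diff finite_subset insertCI subsetD)
    ultimately show ?thesis unfolding T by simp
  qed
  then have "(\<Sum>A\<in>Pow (E - {e}). q ^ components_on (F \<union> S) (adj (insert e A) \<union> S \<times> S) * w ^ card (insert e A))
      = w * Zc (F - {u}) ?S (E - {e})"
    unfolding Zc_def sum_distrib_left by (rule sum.cong[OF refl])
  then show ?thesis
    by (simp add: Zc_def sum_Pow_remove[OF assms(1,2)])
qed

text \<open>Both ends are merged already, so \<open>e\<close> never affects connectivity: it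
  contributes 1 when absent and \<open>w\<close> when present.\<close>

lemma Zc_loop:
  assumes "finite E" "e \<in> E" "ends G e = {s, u}" "s \<in> S" "u \<in> S"
  shows "Zc F S E = (1 + w) * Zc F S (E - {e})"
proof -
  have "q ^ components_on (F \<union> S) (adj (insert e A) \<union> S \<times> S) * w ^ card (insert e A)
      = w * (q ^ components_on (F \<union> S) (adj A \<union> S \<times> S) * w ^ card A)"
    if A: "A \<in> Pow (E - {e})" for A
  proof -
    have "adj (insert e A) \<union> S \<times> S = adj A \<union> S \<times> S"
      using adj_insert[OF assms(3)] assms by auto
    moreover have "card (insert e A) = Suc (card A)"
      using A assms(1) by (metis DiffE PowD Pow_iff card_insert_disjoint finite_Diff finite_subset insertCI subsetD)
    ultimately show ?thesis by simp
  qed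
  then have "(\<Sum>A\<in>Pow (E - {e}). q ^ components_on (F \<union> S) (adj (insert e A) \<union> S \<times> S) * w ^ card (insert e A))
      = w * Zc F S (E - {e})"
    unfolding Zc_def sum_distrib_left by (rule sum.cong[OF refl])
  then show ?thesis
    by (simp add: Zc_def sum_Pow_remove[OF assms(1,2)] algebra_simps)
qed

text \<open>Whatever edges are chosen, \<open>S\<close> remains a component of its own, which
  accounts for the factor \<open>q\<close>.\<close>

lemma Zc_isolated:
  assumes "config F S E" "S \<noteq> {}" "\<And>e. e \<in> E \<Longrightarrow> ends G e \<inter> S = {}"
  shows "Zc F S E = q * Zc F {} E"
proof -
  have "components_on (F \<union> S) (adj A \<union> S \<times> S) = Suc (components_on F (adj A))" if "A \<in> Pow E" for A
  proof (rule components_on_contracted)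
    have "ends G e \<subseteq> F" if "e \<in> A" for e
      using assms(1,3) \<open>A \<in> Pow E\<close> that unfolding config_def by blast
    then show "adj A \<subseteq> F \<times> F" by (auto simp: adjacent_via_def)
  qed (use assms config_finite in \<open>auto simp: config_def\<close>)
  then show ?thesis
    unfolding Zc_def sum_distrib_left by (intro sum.cong[OF refl]) simp
qed

text \<open>Merging a one-element set adds only a reflexive pair. This is how an ordinary polynomial
  enters the recursion with a start vertex \<open>u\<close>.\<close>

lemma Zc_singleton: "u \<in> F \<Longrightarrow> Zc (F - {u}) {u} E = Zc F {} E"
proof -
  assume "u \<in> F"
  then have "F - {u} \<union> {u} = F \<union> {}" by blast
  moreover have "components_on F (adj A \<union> {u} \<times> {u}) = components_on F (adj A)" for A
    by (rule components_on_cong) auto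
  ultimately show ?thesis by (simp add: Zc_def)
qed

text \<open>
  Truncated evaluations of \<open>ratio F S E\<close>, where \<open>b\<close> bounds the number of contractions along a branch.
  The choice of the edge is left open, so that the program may pick any.
\<close>

inductive approx :: "nat \<Rightarrow> 'v set \<Rightarrow> 'v set \<Rightarrow> 'e set \<Rightarrow> complex \<Rightarrow> bool" where
  leaf: "b = 0 \<or> (\<forall>e\<in>E. ends G e \<inter> S = {}) \<Longrightarrow> approx b F S E 1"
| loop: "e \<in> E \<Longrightarrow> ends G e = {s, u} \<Longrightarrow> s \<in> S \<Longrightarrow> u \<in> S \<Longrightarrow> approx b F S (E - {e}) z \<Longrightarrow>
    approx b F S E ((1 + w) * z)"
| branch: "e \<in> E \<Longrightarrow> ends G e = {s, u} \<Longrightarrow> s \<in> S \<Longrightarrow> u \<in> F \<Longrightarrow>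
    approx (Suc b) F S (E - {e}) z1 \<Longrightarrow>
    approx b (F - {u}) (insert u S) (E - {e}) z2 \<Longrightarrow>
    approx b (F - {u}) {u} (induced F E) z3 \<Longrightarrow>
    approx (Suc b) F S E (z1 + w / q * z2 / z3)"

section \<open>Uniform bounds on truncated values\<close>

abbreviation "M \<equiv> 2 + cmod w"
abbreviation "r \<equiv> cmod (w / q)"

text \<open>The measure behind all estimates: using up an edge at \<open>S\<close> lowers it by one,
  and a contraction raises it by at most \<Delta>.\<close>

definition active :: "'v set \<Rightarrow> 'e set \<Rightarrow> nat" where
  "active S E = card {e \<in> E. ends G e \<inter> S \<noteq> {}}"

lemma ratio_small: "12 * (real \<Delta> + 1) * (r * M ^ (2 * \<Delta>)) \<le> 1"
  using q_large q_nonzero by (simp add: norm_divide field_simps)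

lemma r_M_small: "i \<le> 2 * \<Delta> \<Longrightarrow> 12 * (r * M ^ i) \<le> 1"
proof -
  assume "i \<le> 2 * \<Delta>"
  then have "M ^ i \<le> M ^ (2 * \<Delta>)" by (intro power_increasing) auto
  then have "12 * (r * M ^ i) \<le> 12 * (r * M ^ (2 * \<Delta>))"
    by (intro mult_left_mono) auto
  also have "\<dots> \<le> 12 * (real \<Delta> + 1) * (r * M ^ (2 * \<Delta>))"
    by (intro mult_right_mono) auto
  finally show ?thesis using ratio_small by linarith
qed

lemma card_incident:
  assumes "E \<subseteq> edges G" "u \<in> verts G"
  shows "card {e \<in> E. u \<in> ends G e} \<le> \<Delta>"
proof -
  have "card {e \<in> E. u \<in> ends G e} \<le> vertex_degree G u"
    unfolding vertex_degree_def using assms finite_edges by (intro card_mono) auto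
  then show ?thesis using degree[OF assms(2)] by simp
qed

lemma active_singleton:
  "E \<subseteq> edges G \<Longrightarrow> u \<in> verts G \<Longrightarrow> active {u} E \<le> \<Delta>"
  using card_incident[of E u] by (simp add: active_def)

lemma active_delete:
  assumes "finite E" "e \<in> E" "s \<in> ends G e" "s \<in> S"
  shows "active S E = Suc (active S (E - {e}))"
proof -
  have "{e \<in> E. ends G e \<inter> S \<noteq> {}} = insert e {e' \<in> E - {e}. ends G e' \<inter> S \<noteq> {}}"
    using assms by blast
  then show ?thesis using assms(1) by (simp add: active_def)
qed

lemma active_contract:
  assumes "E \<subseteq> edges G" "u \<in> verts G"
  shows "active (insert u S) E \<le> active S E + \<Delta>"
proof -
  have "finite E" using assms(1) finite_edges finite_subset by blast
  have "{e \<in> E. ends G e \<inter> insert u S \<noteq> {}} = {e \<in> E. ends G e \<inter> S \<noteq> {}} \<union> {e \<in> E. u \<in> ends G e}"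
    by blast
  then show ?thesis
    using card_Un_le[of "{e \<in> E. ends G e \<inter> S \<noteq> {}}" "{e \<in> E. u \<in> ends G e}"]
      card_incident[OF assms] by (simp add: active_def)
qed

lemma config_edges: "config F S E \<Longrightarrow> E \<subseteq> edges G"
  and config_verts: "config F S E \<Longrightarrow> u \<in> F \<Longrightarrow> u \<in> verts G"
  by (auto simp: config_def)

text \<open>A contraction lowers the budget, while deletion and loop removal keep it and shrink
  \<open>E\<close>; hence an induction on \<open>card E\<close> inside the one on the
  budget.\<close>

lemma approx_exists: "config F S E \<Longrightarrow> \<exists>z. approx b F S E z"
proof (induction b arbitrary: F S E)
  case 0
  then show ?case using approx.leaf by blast
next
  case (Suc b)
  have "finite E" using Suc.prems config_finite by blast
  then show ?case using Suc.prems
  proof (induction "card E" arbitrary: E rule: less_induct)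
    case (less E)
    show ?case
    proof (cases "\<forall>e\<in>E. ends G e \<inter> S = {}")
      case True
      then show ?thesis using approx.leaf by blast
    next
      case False
      then obtain e s where e: "e \<in> E" "s \<in> ends G e" "s \<in> S" by blast
      then have "card (ends G e) = 2" using less.prems config_edges card_ends by blast
      with e obtain u where u: "ends G e = {s, u}" by (metis card_2_iff doubleton_eq_iff insertE singletonD)
      have "card (E - {e}) < card E" using e less.prems by (meson card_Diff1_less)
      then obtain z1 where z1: "approx (Suc b) F S (E - {e}) z1"
        using less.hyps[of "E - {e}"] less.prems config_delete by blast
      show ?thesis
      proof (cases "u \<in> S")
        case True
        then show ?thesis using approx.loop[OF e(1) u e(3) _ z1] by blast
      next
        case False
        then have F: "u \<in> F" using less.prems u e unfolding config_def by blast
        then obtain z2 z3 where "approx b (F - {u}) (insert u S) (E - {e}) z2"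
          "approx b (F - {u}) {u} (induced F E) z3"
          using Suc.IH config_contract[OF less.prems(2) F] config_restrict[OF less.prems(2) F] by meson
        then show ?thesis using approx.branch[OF e(1) u e(3) F z1] by blast
      qed
    qed
  qed
qed

text \<open>The most that one contraction can move a value with singleton \<open>S\<close>: the 2
  stems from a denominator of modulus at least 1/2, and the power bounds the numerator. The
  condition on \<open>q\<close> gives \<open>(\<Delta> + 1) * \<eta> \<le> 1 / 6\<close>.\<close>

definition \<eta> :: real where "\<eta> = 2 * r * M ^ (2 * \<Delta>)"

lemma eta_nonneg: "0 \<le> \<eta>"
  by (simp add: \<eta>_def)

lemma half_le_norm:
  assumes "cmod (z - 1) \<le> real k * \<eta>" "k \<le> \<Delta>"
  shows "1 / 2 \<le> cmod z"
proof -
  have "real k * \<eta> \<le> real \<Delta> * \<eta>"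
    using assms(2) eta_nonneg by (intro mult_right_mono) auto
  also have "\<dots> \<le> (real \<Delta> + 1) * \<eta>" using eta_nonneg by (intro mult_right_mono) auto
  also have "\<dots> \<le> 1 / 6" using ratio_small by (simp add: \<eta>_def algebra_simps)
  finally have "cmod (z - 1) \<le> 1 / 2" using assms(1) by simp
  then show ?thesis
    using norm_triangle_ineq2[of 1 "1 - z"] by (simp add: norm_minus_commute)
qed

text \<open>The two bounds need each other. The modulus bound at a branch requires a denominator
  away from 0, which is the singleton bound for the third child; the singleton bound requires the
  modulus of the second child, whose merged set is larger. A branch costs at most a factor 2,
  because its second summand is no larger than the bound on \<open>z1\<close>, and a loop costs at
  most \<open>1 + cmod w\<close>; \<open>M\<close> covers both.\<close>

lemma approx_bounds:
  assumes "approx b F S E z" "config F S E"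
  shows "cmod z \<le> M ^ active S E" and "S = {v} \<Longrightarrow> cmod (z - 1) \<le> real (active S E) * \<eta>"
proof -
  have "cmod z \<le> M ^ active S E \<and> (\<forall>v. S = {v} \<longrightarrow> cmod (z - 1) \<le> real (active S E) * \<eta>)"
    using assms
  proof (induction rule: approx.induct)
    case (leaf b E S F)
    then show ?case using eta_nonneg by (simp add: one_le_power)
  next
    case (loop e E s u S b F z)
    have fin: "finite E" using loop.prems config_finite by blast
    have a: "active S E = Suc (active S (E - {e}))"
      using active_delete[OF fin loop(1)] loop(2,3) by blast
    have "cmod ((1 + w) * z) \<le> M * M ^ active S (E - {e})"
      unfolding norm_mult
      using loop.IH[OF config_delete[OF loop.prems]] norm_triangle_ineq[of 1 w]
      by (intro mult_mono) auto
    \<comment> \<open>An edge with both ends in a singleton would be a loop of \<open>G\<close>, so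
      the factor \<open>1 + w\<close> never spoils the bound near 1.\<close>
    moreover have "S \<noteq> {v}" for v
    proof
      assume "S = {v}"
      then have "ends G e = {v}" using loop by auto
      then show False using card_ends[of e] config_edges[OF loop.prems] loop(1) by auto
    qed
    ultimately show ?case by (simp add: a)
  next
    case (branch e E s u S F b z1 z2 z3)
    have fin: "finite E" using branch.prems config_finite by blast
    have u: "u \<in> verts G" using branch config_verts by blast
    have a: "active S E = Suc (active S (E - {e}))"
      using active_delete[OF fin branch(1)] branch(2,3) by blast
    let ?a = "active S (E - {e})"
    have z1: "cmod z1 \<le> M ^ ?a" "S = {v} \<Longrightarrow> cmod (z1 - 1) \<le> real ?a * \<eta>" for v
      using branch.IH(1)[OF config_delete[OF branch.prems]] by auto
    have "active (insert u S) (E - {e}) \<le> ?a + \<Delta>"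
      using active_contract[of "E - {e}" u S] config_edges[OF branch.prems] u by blast
    then have "M ^ active (insert u S) (E - {e}) \<le> M ^ (?a + \<Delta>)"
      by (intro power_increasing) auto
    then have z2: "cmod z2 \<le> M ^ (?a + \<Delta>)"
      using branch.IH(2)[OF config_contract[OF branch.prems branch(4)]] by linarith
    have "active {u} (induced F E) \<le> \<Delta>"
      using config_edges[OF branch.prems] u by (intro active_singleton) (auto simp: induced_def)
    then have z3: "1 / 2 \<le> cmod z3"
      using branch.IH(3)[OF config_restrict[OF branch.prems branch(4)]] half_le_norm by blast
    have "cmod z2 / cmod z3 \<le> M ^ (?a + \<Delta>) / (1 / 2)"
      using z2 z3 by (intro frac_le) auto
    then have "r * (cmod z2 / cmod z3) \<le> r * (2 * M ^ (?a + \<Delta>))"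
      by (intro mult_left_mono) auto
    then have d: "cmod (w / q * z2 / z3) \<le> 2 * r * M ^ (?a + \<Delta>)"
      by (simp add: norm_mult norm_divide mult.assoc mult.left_commute)
    have "2 * r * M ^ (?a + \<Delta>) = M ^ ?a * (2 * (r * M ^ \<Delta>))"
      by (simp add: power_add)
    also have "\<dots> \<le> M ^ ?a * 1"
      using r_M_small[of \<Delta>] by (intro mult_left_mono) (auto simp: mult.commute intro: order_trans)
    finally have "cmod (z1 + w / q * z2 / z3) \<le> 2 * M ^ ?a"
      using norm_triangle_ineq[of z1 "w / q * z2 / z3"] d z1(1) by linarith
    also have "\<dots> \<le> M * M ^ ?a" by (intro mult_right_mono) auto
    finally have 1: "cmod (z1 + w / q * z2 / z3) \<le> M ^ active S E" by (simp add: a)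
    have 2: "cmod (z1 + w / q * z2 / z3 - 1) \<le> real (active S E) * \<eta>" if S: "S = {v}" for v
    proof -
      have "v = s" using S branch(3) by simp
      then have "v \<in> verts G" using branch.prems S unfolding config_def by blast
      then have "active S E \<le> \<Delta>"
        using S config_edges[OF branch.prems] active_singleton by blast
      then have "M ^ (?a + \<Delta>) \<le> M ^ (2 * \<Delta>)" using a by (intro power_increasing) auto
      then have "2 * r * M ^ (?a + \<Delta>) \<le> \<eta>"
        unfolding \<eta>_def by (intro mult_left_mono) auto
      then show ?thesis
        using norm_triangle_ineq[of "z1 - 1" "w / q * z2 / z3"] d z1(2)[OF S] a
        by (simp add: algebra_simps)
    qed
    show ?case using 1 2 by blast
  qed
  then show "cmod z \<le> M ^ active S E" and "S = {v} \<Longrightarrow> cmod (z - 1) \<le> real (active S E) * \<eta>"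
    by auto
qed

lemma approx_singleton_ge_half:
  assumes "approx b F {v} E z" "config F {v} E"
  shows "1 / 2 \<le> cmod z"
proof -
  have "v \<in> verts G" "E \<subseteq> edges G" using assms(2) by (auto simp: config_def)
  then show ?thesis
    using half_le_norm approx_bounds(2)[OF assms refl] active_singleton by blast
qed

section \<open>Exactness for a large budget and absence of zeros\<close>

lemma induced_idem: "u \<in> F \<Longrightarrow> induced (F - {u}) (induced F E) = induced (F - {u}) E"
  by (auto simp: induced_def)

text \<open>Contraction lowers \<open>card F\<close> and the budget together, so with
  \<open>card F < b\<close> the cut-off never strikes and every leaf is a genuine one. The claim is
  stated as a product because the polynomial on the right is not yet known to be nonzero.\<close>

lemma approx_exact:
  assumes "approx b F S E z" "config F S E" "card F < b" "S \<noteq> {}"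
  shows "Zc F S E = z * q * Zc F {} (induced F E)"
  using assms
proof (induction rule: approx.induct)
  case (leaf b E S F)
  then have "\<forall>e\<in>E. ends G e \<inter> S = {}" by auto
  moreover from this have "induced F E = E"
    using leaf.prems(1) unfolding config_def induced_def by blast
  ultimately show ?case using Zc_isolated[OF leaf.prems(1,3)] by simp
next
  case (loop e E s u S b F z)
  have "induced F (E - {e}) = induced F E"
    using loop(2,3) loop.prems(1) unfolding config_def induced_def by blast
  then show ?case
    using loop.IH[OF config_delete[OF loop.prems(1)] loop.prems(2,3)]
      Zc_loop[OF _ loop(1-4)] config_finite[OF loop.prems(1)] by simp
next
  case (branch e E s u S F b z1 z2 z3)
  note cf = branch.prems(1)
  have fin: "finite E" "finite F" using config_finite[OF cf] by auto
  have c: "card (F - {u}) < b" using branch.prems(2) branch(4) fin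
    by (metis One_nat_def card_Diff_singleton card_gt_0_iff diff_Suc_less empty_iff less_Suc_eq less_trans_Suc not_less_eq order_less_le_trans linorder_not_less)
  have sF: "s \<notin> F" using cf branch(3) unfolding config_def by blast
  have i1: "induced F (E - {e}) = induced F E"
    using branch(2) sF unfolding induced_def by blast
  have i2: "induced (F - {u}) (E - {e}) = induced (F - {u}) E"
    using branch(2) unfolding induced_def by blast
  let ?Y = "Zc (F - {u}) {} (induced (F - {u}) E)"
  have 1: "Zc F S (E - {e}) = z1 * q * Zc F {} (induced F E)"
    using branch.IH(1)[OF config_delete[OF cf] branch.prems(2,3)] i1 by simp
  have 2: "Zc (F - {u}) (insert u S) (E - {e}) = z2 * q * ?Y"
    using branch.IH(2)[OF config_contract[OF cf branch(4)] c] i2 by simp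
  \<comment> \<open>The normalising polynomial of the node is itself one with merged set
    \<open>{u}\<close>. This converts the normalisation of the contracted child into that of the
    node, at the price of dividing by \<open>q\<close> and \<open>z3\<close>.\<close>
  have 3: "Zc F {} (induced F E) = z3 * q * ?Y"
    using branch.IH(3)[OF config_restrict[OF cf branch(4)] c]
    by (simp add: Zc_singleton[OF branch(4)] induced_idem[OF branch(4)])
  have "1 / 2 \<le> cmod z3"
    using branch(7) config_restrict[OF cf branch(4)] by (rule approx_singleton_ge_half)
  then have "z3 \<noteq> 0" by auto
  then show ?case
    using Zc_delete_contract[OF fin(1) branch(1-4)] 1 2 3 q_nonzero
    by (simp add: field_simps)
qed

text \<open>Splitting off one vertex multiplies by \<open>q\<close> and a truncated value of modulus
  at least 1/2, both nonzero.\<close>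

lemma Zc_nonzero: "config F {} E \<Longrightarrow> Zc F {} E \<noteq> 0"
proof (induction "card F" arbitrary: F E)
  case 0
  then have "F = {}" using config_finite by auto
  moreover have "E = {}"
  proof (rule ccontr)
    assume "E \<noteq> {}"
    then obtain e where "e \<in> E" by blast
    then have "e \<in> edges G" "ends G e = {}" using 0 \<open>F = {}\<close> unfolding config_def by auto
    then show False using card_ends by fastforce
  qed
  ultimately show ?case by (simp add: Zc_def)
next
  case (Suc k)
  then obtain u where u: "u \<in> F" by fastforce
  have i: "induced F E = E" using Suc.prems unfolding config_def induced_def by blast
  have cf: "config (F - {u}) {u} E"
    using config_restrict[OF Suc.prems u] i by simp
  obtain z where z: "approx (Suc (card (F - {u}))) (F - {u}) {u} E z"
    using approx_exists[OF cf] by blast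
  have "1 / 2 \<le> cmod z" using z cf by (rule approx_singleton_ge_half)
  then have "z \<noteq> 0" by auto
  moreover have "Zc F {} E = z * q * Zc (F - {u}) {} (induced (F - {u}) E)"
    using approx_exact[OF z cf] Zc_singleton[OF u] by simp
  moreover have "Zc (F - {u}) {} (induced (F - {u}) E) \<noteq> 0"
    using Suc.hyps(1)[OF _ config_inside[OF cf]] Suc.hyps(2) u config_finite[OF Suc.prems] by simp
  ultimately show ?case using q_nonzero by simp
qed

section \<open>Exact ratios and decay of the truncation error\<close>

definition ratio :: "'v set \<Rightarrow> 'v set \<Rightarrow> 'e set \<Rightarrow> complex" where
  "ratio F S E = Zc F S E / (q * Zc F {} (induced F E))"

text \<open>The exact ratio is itself a truncated value with a large budget, so all bounds proved
  for truncated values apply to it.\<close>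

lemma ratio_approx:
  assumes "config F S E" "S \<noteq> {}"
  shows "approx (Suc (card F)) F S E (ratio F S E)"
proof -
  obtain z where z: "approx (Suc (card F)) F S E z" using approx_exists[OF assms(1)] by blast
  then have "z = ratio F S E"
    using approx_exact[OF z assms(1) _ assms(2)] Zc_nonzero[OF config_inside[OF assms(1)]] q_nonzero
    by (simp add: ratio_def)
  with z show ?thesis by simp
qed

lemma quotient_error:
  fixes x y x' y' :: complex
  assumes "1 / 2 \<le> cmod y" "1 / 2 \<le> cmod y'" "cmod x \<le> B"
    "cmod (x' - x) \<le> \<alpha>" "cmod (y' - y) \<le> \<beta>"
  shows "cmod (x' / y' - x / y) \<le> 2 * \<alpha> + 4 * B * \<beta>"
proof -
  have nz: "y \<noteq> 0" "y' \<noteq> 0" using assms by auto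
  have "x' / y' - x / y = (x' - x) / y' - x * (y' - y) / (y * y')"
    using nz by (simp add: field_simps)
  then have "cmod (x' / y' - x / y) \<le> cmod (x' - x) / cmod y' + cmod x * cmod (y' - y) / (cmod y * cmod y')"
    using norm_triangle_ineq4[of "(x' - x) / y'" "x * (y' - y) / (y * y')"]
    by (simp add: norm_divide norm_mult)
  moreover have "cmod (x' - x) / cmod y' \<le> \<alpha> / (1 / 2)"
    using assms(2,4) order_trans[OF norm_ge_zero assms(4)] by (intro frac_le) auto
  moreover have "cmod x * cmod (y' - y) / (cmod y * cmod y') \<le> B * \<beta> / (1 / 2 * (1 / 2))"
  proof (rule frac_le)
    show "0 \<le> B * \<beta>" using assms norm_ge_zero[of x] norm_ge_zero[of "y' - y"]
      by (intro mult_nonneg_nonneg) linarith+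
    show "cmod x * cmod (y' - y) \<le> B * \<beta>" using assms order_trans[OF norm_ge_zero assms(3)]
      by (intro mult_mono) auto
    show "1 / 2 * (1 / 2) \<le> cmod y * cmod y'" using assms by (intro mult_mono) auto
  qed simp
  ultimately show ?thesis by simp
qed

lemma ratio_leaf:
  assumes "config F S E" "S \<noteq> {}" "\<And>e. e \<in> E \<Longrightarrow> ends G e \<inter> S = {}"
  shows "ratio F S E = 1"
proof -
  have "induced F E = E" using assms(1,3) unfolding config_def induced_def by blast
  then show ?thesis
    using Zc_isolated[OF assms] Zc_nonzero[OF config_inside[OF assms(1)]] q_nonzero
    by (simp add: ratio_def)
qed

lemma ratio_loop:
  assumes "config F S E" "e \<in> E" "ends G e = {s, u}" "s \<in> S" "u \<in> S"
  shows "ratio F S E = (1 + w) * ratio F S (E - {e})"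
proof -
  have "induced F (E - {e}) = induced F E"
    using assms unfolding config_def induced_def by blast
  then show ?thesis
    using Zc_loop[OF _ assms(2-5)] config_finite[OF assms(1)] by (simp add: ratio_def)
qed

text \<open>The contracted term is naturally normalised by the polynomial on \<open>F - {u}\<close>.
  Passing to the normalisation on \<open>F\<close> divides by the quotient of the two polynomials,
  which is \<open>q\<close> times a ratio with singleton merged set.\<close>

lemma ratio_branch:
  assumes "config F S E" "e \<in> E" "ends G e = {s, u}" "s \<in> S" "u \<in> F"
  shows "ratio F S E = ratio F S (E - {e}) +
    w / q * ratio (F - {u}) (insert u S) (E - {e}) / ratio (F - {u}) {u} (induced F E)"
proof -
  have "s \<notin> F" using assms(1,4) unfolding config_def by blast
  then have i1: "induced F (E - {e}) = induced F E"
    using assms(3) unfolding induced_def by blast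
  have i2: "induced (F - {u}) (E - {e}) = induced (F - {u}) E"
    using assms(3) unfolding induced_def by blast
  have "Zc (F - {u}) {} (induced (F - {u}) E) \<noteq> 0" "Zc F {} (induced F E) \<noteq> 0"
    using Zc_nonzero[OF config_inside[OF assms(1)]]
      Zc_nonzero[OF config_inside[OF config_restrict[OF assms(1,5)]]]
    by (simp_all add: induced_idem[OF assms(5)])
  then show ?thesis
    using Zc_delete_contract[OF _ assms(2-5)] config_finite[OF assms(1)] q_nonzero
    by (simp add: ratio_def i1 i2 induced_idem[OF assms(5)] Zc_singleton[OF assms(5)] field_simps)
qed

text \<open>A contraction consumes one unit of budget, so the errors of its two children are known
  only with exponent \<open>b\<close> instead of \<open>Suc b\<close>. The smallness of
  \<open>w / q\<close> compensates for this and for the growth of \<open>M ^ active\<close>; the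
  deleted and the contracted part then contribute equally, and \<open>2 \<le> M\<close> absorbs
  their sum.\<close>

lemma approx_error:
  assumes "approx b F S E z" "config F S E" "S \<noteq> {}"
  shows "cmod (z - ratio F S E) \<le> 2 * M ^ active S E * (1 / 2) ^ b"
  using assms
proof (induction rule: approx.induct)
  case (leaf b E S F)
  show ?case
  proof (cases "b = 0")
    case True
    \<comment> \<open>At a cut-off the ratio is replaced by 1. The error is at most 1 plus the
      modulus of the ratio, which is where the leading 2 of the bound comes from.\<close>
    have "cmod (ratio F S E) \<le> M ^ active S E"
      using approx_bounds(1)[OF ratio_approx[OF leaf.prems] leaf.prems(1)] .
    moreover have "1 \<le> M ^ active S E" by (intro one_le_power) auto
    ultimately show ?thesis
      using True norm_triangle_ineq4[of 1 "ratio F S E"] by (simp del: one_le_power)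
  next
    case False
    then show ?thesis using leaf ratio_leaf[OF leaf.prems] by simp
  qed
next
  case (loop e E s u S b F z)
  have fin: "finite E" using loop.prems config_finite by blast
  have a: "active S E = Suc (active S (E - {e}))"
    using active_delete[OF fin loop(1)] loop(2,3) by blast
  have "cmod ((1 + w) * z - ratio F S E) = cmod (1 + w) * cmod (z - ratio F S (E - {e}))"
    unfolding ratio_loop[OF loop.prems(1) loop(1-4)] by (simp add: norm_mult flip: right_diff_distrib)
  also have "\<dots> \<le> M * (2 * M ^ active S (E - {e}) * (1 / 2) ^ b)"
    using loop.IH[OF config_delete[OF loop.prems(1)] loop.prems(2)] norm_triangle_ineq[of 1 w]
    by (intro mult_mono) auto
  finally show ?case by (simp add: a algebra_simps)
next
  case (branch e E s u S F b z1 z2 z3)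
  note cf = branch.prems(1)
  note cf2 = config_contract[OF cf branch(4)]
  note cf3 = config_restrict[OF cf branch(4)]
  have fin: "finite E" using cf config_finite by blast
  have u: "u \<in> verts G" using branch config_verts by blast
  have a: "active S E = Suc (active S (E - {e}))"
    using active_delete[OF fin branch(1)] branch(2,3) by blast
  let ?a = "active S (E - {e})" and ?t = "(1 / 2 :: real) ^ b"
  let ?r2 = "ratio (F - {u}) (insert u S) (E - {e})" and ?r3 = "ratio (F - {u}) {u} (induced F E)"
  have 1: "cmod (z1 - ratio F S (E - {e})) \<le> M ^ ?a * ?t"
    using branch.IH(1)[OF config_delete[OF cf] branch.prems(2)] by simp
  have "active (insert u S) (E - {e}) \<le> ?a + \<Delta>"
    using active_contract[of "E - {e}" u S] config_edges[OF cf] u by blast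
  then have p: "M ^ active (insert u S) (E - {e}) \<le> M ^ (?a + \<Delta>)"
    by (intro power_increasing) auto
  then have r2: "cmod ?r2 \<le> M ^ (?a + \<Delta>)"
    by (rule order_trans[OF approx_bounds(1)[OF ratio_approx[OF cf2 insert_not_empty] cf2]])
  have "2 * M ^ active (insert u S) (E - {e}) * ?t \<le> 2 * M ^ (?a + \<Delta>) * ?t"
    using p by (intro mult_right_mono mult_left_mono) auto
  then have 2: "cmod (z2 - ?r2) \<le> 2 * M ^ (?a + \<Delta>) * ?t"
    by (rule order_trans[OF branch.IH(2)[OF cf2 insert_not_empty]])
  have "active {u} (induced F E) \<le> \<Delta>"
    using config_edges[OF cf] u by (intro active_singleton) (auto simp: induced_def)
  then have "M ^ active {u} (induced F E) \<le> M ^ \<Delta>"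
    by (intro power_increasing) auto
  then have "2 * M ^ active {u} (induced F E) * ?t \<le> 2 * M ^ \<Delta> * ?t"
    by (intro mult_right_mono mult_left_mono) auto
  then have 3: "cmod (z3 - ?r3) \<le> 2 * M ^ \<Delta> * ?t"
    by (rule order_trans[OF branch.IH(3)[OF cf3 insert_not_empty]])
  have h: "1 / 2 \<le> cmod ?r3" "1 / 2 \<le> cmod z3"
    using approx_singleton_ge_half[OF ratio_approx[OF cf3] cf3]
      approx_singleton_ge_half[OF branch(7) cf3] by auto
  have "cmod (z2 / z3 - ?r2 / ?r3) \<le> 2 * (2 * M ^ (?a + \<Delta>) * ?t) + 4 * M ^ (?a + \<Delta>) * (2 * M ^ \<Delta> * ?t)"
    by (rule quotient_error[OF h r2 2 3])
  \<comment> \<open>The summand with factor 4 has one power \<open>M ^ \<Delta>\<close> less than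
    the one with factor 8; since that power is at least 1, both combine to 12, the constant in the
    condition on \<open>q\<close>.\<close>
  also have "\<dots> \<le> 12 * (M ^ ?a * M ^ (2 * \<Delta>) * ?t)"
  proof -
    have "2 * (2 * (A * D) * t) + 4 * (A * D) * (2 * D * t) \<le> 12 * (A * (D * D) * t)"
      if "0 \<le> A" "1 \<le> D" "0 \<le> t" for A D t :: real
    proof -
      have "A * t * D * 1 \<le> A * t * D * D" using that by (intro mult_left_mono) auto
      then show ?thesis by (simp add: mult_ac)
    qed
    from this[of "M ^ ?a" "M ^ \<Delta>" ?t] show ?thesis
      by (simp only: power_add mult_2 one_le_power zero_le_power norm_ge_zero) simp
  qed
  finally have "r * cmod (z2 / z3 - ?r2 / ?r3) \<le> r * (12 * (M ^ ?a * M ^ (2 * \<Delta>) * ?t))"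
    by (intro mult_left_mono) auto
  also have "\<dots> = (12 * (r * M ^ (2 * \<Delta>))) * (M ^ ?a * ?t)" by simp
  also have "\<dots> \<le> 1 * (M ^ ?a * ?t)"
    using r_M_small[of "2 * \<Delta>"] by (intro mult_right_mono) auto
  finally have d: "cmod (w / q * (z2 / z3 - ?r2 / ?r3)) \<le> M ^ ?a * ?t"
    unfolding norm_mult mult_1_left .
  have eq: "z1 + w / q * z2 / z3 - ratio F S E = (z1 - ratio F S (E - {e})) + w / q * (z2 / z3 - ?r2 / ?r3)"
    unfolding ratio_branch[OF cf branch(1-4)] by (simp add: algebra_simps)
  have "cmod (z1 + w / q * z2 / z3 - ratio F S E) \<le> 2 * M ^ ?a * ?t"
    unfolding eq using norm_triangle_ineq[of "z1 - ratio F S (E - {e})" "w / q * (z2 / z3 - ?r2 / ?r3)"] 1 d by linarith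
  also have "\<dots> \<le> M * M ^ ?a * ?t" by (intro mult_right_mono) auto
  finally show ?case by (simp add: a)
qed

end

section \<open>From accurate ratios to an approximation of the polynomial\<close>

lemma mult_approx_if_quotient_near_1:
  assumes "\<xi> \<noteq> 0" and near: "cmod (x / \<xi> - 1) \<le> min 1 \<epsilon> / 4"
  shows "mult_approx \<epsilon> \<xi> x"
proof -
  define t where "t = x / \<xi>"
  \<comment> \<open>The real part of \<open>L\<close> is the logarithm of the quotient of the moduli
    and its imaginary part the signed angle. A bound on \<open>cmod L\<close> controls both; being
    at most 1, the angle is in the range where \<open>arccos\<close> inverts
    \<open>cos\<close>.\<close>
  define L where "L = Ln t"
  have t1: "cmod (t - 1) < 1 / 2" using near by (simp add: t_def)
  then have t0: "t \<noteq> 0" by auto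
  have expL: "exp L = t" using t0 by (simp add: L_def)
  have "cmod L \<le> 2 * cmod (t - 1)"
    using norm_Ln_le[of "t - 1"] t1 by (simp add: L_def)
  then have L: "cmod L \<le> min 1 \<epsilon>" using near norm_ge_zero[of "t - 1"] unfolding t_def by linarith
  have x: "x = \<xi> * exp L" using assms(1) expL by (simp add: t_def)
  have Re: "\<bar>Re L\<bar> \<le> \<epsilon>" and Im: "\<bar>Im L\<bar> \<le> \<epsilon>" "\<bar>Im L\<bar> \<le> 1"
    using L norm_ge_zero[of L] abs_Re_le_cmod[of L] abs_Im_le_cmod[of L] by linarith+
  have "\<xi> \<bullet> x = (cmod \<xi>)\<^sup>2 * (exp (Re L) * cos (Im L))"
  proof -
    have "\<xi> \<bullet> x = Re (cnj \<xi> * x)" by (simp add: inner_complex_def)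
    also have "\<dots> = Re (of_real ((cmod \<xi>)\<^sup>2) * exp L)"
      by (simp add: x complex_norm_square[symmetric] mult.assoc[symmetric] mult.commute)
    finally show ?thesis by (simp add: Re_exp)
  qed
  then have "(\<xi> \<bullet> x) / (cmod \<xi> * cmod x) = cos (Im L)"
    using assms(1) by (simp add: x norm_mult norm_exp_eq_Re power2_eq_square)
  moreover have "arccos (cos (Im L)) = \<bar>Im L\<bar>"
    using Im(2) pi_gt3 by (intro arccos_cos_eq_abs) linarith
  ultimately have "angle_between \<xi> x \<le> \<epsilon>" using Im(1) by (simp add: angle_between_def)
  moreover have "cmod x / cmod \<xi> = exp (Re L)"
    using assms(1) by (simp add: x norm_mult norm_exp_eq_Re)
  ultimately show ?thesis using Re assms(1) by (simp add: mult_approx_def x abs_le_iff)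
qed

context bounded_degree_graph
begin

text \<open>A telescoping product: the vertices are removed in the order of their numbers, and each
  removal yields \<open>q\<close> times a ratio with that vertex as merged set.\<close>

lemma Zc_eq_prod_ratio:
  assumes f: "bij_betw f {..<n} (verts G)" and "i \<le> n"
  shows "Zc (f ` {i..<n}) {} (induced (f ` {i..<n}) (edges G)) =
    q ^ (n - i) * (\<Prod>k=i..<n. ratio (f ` {Suc k..<n}) {f k} (induced (f ` {k..<n}) (edges G)))"
  using assms(2)
proof (induction rule: inc_induct)
  case base
  have "ends G e \<noteq> {}" if "e \<in> edges G" for e
    using card_ends[OF that] by auto
  then have "induced (f ` {n..<n}) (edges G) = {}" by (auto simp: induced_def)
  then show ?case by (simp add: Zc_def)
next
  case (step i)
  let ?F = "f ` {i..<n}" and ?F' = "f ` {Suc i..<n}"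
  have u: "f i \<in> ?F" using step.hyps by auto
  have "{i..<n} - {i} = {Suc i..<n}" by auto
  moreover have "f ` ({i..<n} - {i}) = f ` {i..<n} - f ` {i}"
    using f step.hyps by (intro inj_on_image_set_diff[of f "{..<n}"]) (auto simp: bij_betw_def)
  ultimately have F': "?F - {f i} = ?F'" by simp
  let ?E = "induced ?F (edges G)"
  have "?F \<subseteq> verts G" using f by (auto simp: bij_betw_def)
  then have "config ?F {} ?E" by (auto simp: config_def induced_def)
  then have cf: "config ?F' {f i} ?E"
    using config_restrict[OF _ u] F' by (fastforce simp: induced_def)
  have i': "induced ?F' ?E = induced ?F' (edges G)"
    using F' by (auto simp: induced_def)
  have "Zc ?F {} ?E = Zc ?F' {f i} ?E" using Zc_singleton[OF u] F' by simp
  also have "\<dots> = ratio ?F' {f i} ?E * q * Zc ?F' {} (induced ?F' (edges G))"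
    using Zc_nonzero[OF config_inside[OF cf]] q_nonzero by (simp add: ratio_def i')
  also have "\<dots> = q ^ (n - i) * (\<Prod>k=i..<n. ratio (f ` {Suc k..<n}) {f k} (induced (f ` {k..<n}) (edges G)))"
    using step by (simp add: prod.atLeast_Suc_lessThan Suc_diff_Suc[symmetric])
  finally show ?case .
qed

lemma config_root:
  assumes f: "bij_betw f {..<n} (verts G)" and "i < n"
  shows "config (f ` {Suc i..<n}) {f i} (induced (f ` {i..<n}) (edges G))"
proof -
  have "f i \<notin> f ` {Suc i..<n}" using f assms(2) by (fastforce simp: bij_betw_def dest: inj_onD)
  moreover have "{i..<n} = insert i {Suc i..<n}" using assms(2) by auto
  then have "f ` {i..<n} = insert (f i) (f ` {Suc i..<n})" by simp
  ultimately show ?thesis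
    using f assms(2) by (auto simp: config_def induced_def bij_betw_def)
qed

text \<open>Division by \<open>z i\<close>, of modulus at least 1/2, makes the relative error of a
  factor at most \<open>4 * M ^ \<Delta> * (1 / 2) ^ b\<close>. Over \<open>n\<close> factors this
  compounds to an exponential, whose distance from 1 is at most twice its exponent. The 32 is 4 * 2
  * 4, the last 4 for the required quarter of \<open>min 1 \<epsilon>\<close>.\<close>

lemma Z_T_approx:
  assumes f: "bij_betw f {..<n} (verts G)"
    and z: "\<And>i. i < n \<Longrightarrow> approx b (f ` {Suc i..<n}) {f i} (induced (f ` {i..<n}) (edges G)) (z i)"
    and small: "32 * real n * M ^ \<Delta> * (1 / 2) ^ b \<le> min 1 \<epsilon>"
  shows "mult_approx \<epsilon> (q ^ n * (\<Prod>i<n. z i)) (Z_T G q w)"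
proof -
  define \<rho> where "\<rho> = (\<lambda>i. ratio (f ` {Suc i..<n}) {f i} (induced (f ` {i..<n}) (edges G)))"
  let ?t = "(1 / 2 :: real) ^ b"
  have z0: "1 / 2 \<le> cmod (z i)" if "i < n" for i
    using approx_singleton_ge_half[OF z[OF that] config_root[OF f that]] .
  have err: "cmod (\<rho> i / z i - 1) \<le> 4 * M ^ \<Delta> * ?t" if i: "i < n" for i
  proof -
    have "f i \<in> verts G" using f i by (auto simp: bij_betw_def)
    then have "active {f i} (induced (f ` {i..<n}) (edges G)) \<le> \<Delta>"
      by (intro active_singleton) (auto simp: induced_def)
    then have "M ^ active {f i} (induced (f ` {i..<n}) (edges G)) \<le> M ^ \<Delta>"
      by (intro power_increasing) auto
    then have "2 * M ^ active {f i} (induced (f ` {i..<n}) (edges G)) * ?t \<le> 2 * M ^ \<Delta> * ?t"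
      by (intro mult_right_mono mult_left_mono) auto
    then have e: "cmod (z i - \<rho> i) \<le> 2 * M ^ \<Delta> * ?t"
      unfolding \<rho>_def by (rule order_trans[OF approx_error[OF z[OF i] config_root[OF f i] insert_not_empty]])
    have "z i \<noteq> 0" using z0[OF i] by auto
    then have "cmod (\<rho> i / z i - 1) = cmod (z i - \<rho> i) / cmod (z i)"
      by (simp add: field_simps norm_minus_commute flip: norm_divide)
    also have "\<dots> \<le> (2 * M ^ \<Delta> * ?t) / (1 / 2)"
      using e z0[OF i] by (intro frac_le) auto
    finally show ?thesis by simp
  qed
  have zn: "(\<Prod>i<n. z i) \<noteq> 0" using z0 by fastforce
  have "f ` {0..<n} = verts G" using f by (simp add: bij_betw_def atLeast0LessThan)
  moreover have "induced (verts G) (edges G) = edges G" using ends_verts by (auto simp: induced_def)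
  ultimately have "Z_T G q w = q ^ n * (\<Prod>i<n. \<rho> i)"
    using Zc_eq_prod_ratio[OF f, of 0] by (simp add: Z_T_eq_Zc \<rho>_def atLeast0LessThan)
  then have "Z_T G q w / (q ^ n * (\<Prod>i<n. z i)) = (\<Prod>i<n. 1 + (\<rho> i / z i - 1))"
    using q_nonzero by (simp add: prod_dividef)
  then have "cmod (Z_T G q w / (q ^ n * (\<Prod>i<n. z i)) - 1) \<le> (\<Prod>i<n. 1 + cmod (\<rho> i / z i - 1)) - 1"
    using norm_prod_minus1_le_prod_minus1[of "\<lambda>i. \<rho> i / z i - 1" "{..<n}"] by simp
  also have "(\<Prod>i<n. 1 + cmod (\<rho> i / z i - 1)) \<le> (\<Prod>i<n. exp (4 * M ^ \<Delta> * ?t))"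
  proof (rule prod_mono)
    fix i assume "i \<in> {..<n}"
    then have "1 + cmod (\<rho> i / z i - 1) \<le> exp (4 * M ^ \<Delta> * ?t)"
      using order_trans[OF add_left_mono[OF err] exp_ge_add_one_self] by simp
    then show "0 \<le> 1 + cmod (\<rho> i / z i - 1) \<and> 1 + cmod (\<rho> i / z i - 1) \<le> exp (4 * M ^ \<Delta> * ?t)"
      by (simp add: add_nonneg_nonneg)
  qed
  also have "\<dots> = exp (real n * (4 * M ^ \<Delta> * ?t))" by (simp add: exp_of_nat_mult)
  also have "\<dots> \<le> 1 + 2 * (real n * (4 * M ^ \<Delta> * ?t))"
    using small exp_bound_lemma[of "real n * (4 * M ^ \<Delta> * ?t)"] by simp
  finally have "cmod (Z_T G q w / (q ^ n * (\<Prod>i<n. z i)) - 1) \<le> min 1 \<epsilon> / 4"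
    using small by simp
  then show ?thesis using zn q_nonzero by (intro mult_approx_if_quotient_near_1) auto
qed

end

section \<open>Execution with time bounds\<close>

definition halts :: "com \<Rightarrow> nat \<Rightarrow> state \<Rightarrow> (state \<Rightarrow> bool) \<Rightarrow> bool" where
  "halts c T s Q \<longleftrightarrow> (\<exists>t s'. exec c s t s' \<and> t \<le> T \<and> Q s')"

lemma halts_mono: "halts c T s P \<Longrightarrow> T \<le> U \<Longrightarrow> (\<And>s'. P s' \<Longrightarrow> Q s') \<Longrightarrow> halts c U s Q"
  unfolding halts_def by (meson order_trans)

lemma halts_Skip: "Q s \<Longrightarrow> halts Skip 1 s Q"
  unfolding halts_def using exec.Skip by blast

lemma halts_NAssign: "Q (s\<lparr>nreg := (nreg s)(x := nval e s)\<rparr>) \<Longrightarrow> halts (NAssign x e) 1 s Q"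
  unfolding halts_def using exec.NAssign by blast

lemma halts_NStore:
  "Q (s\<lparr>narr := (narr s)(a := (narr s a)(nval i s := nval e s))\<rparr>) \<Longrightarrow> halts (NStore a i e) 1 s Q"
  unfolding halts_def using exec.NStore by blast

lemma halts_CAssign: "Q (s\<lparr>creg := (creg s)(x := cval e s)\<rparr>) \<Longrightarrow> halts (CAssign x e) 1 s Q"
  unfolding halts_def using exec.CAssign by blast

lemma halts_CStore:
  "Q (s\<lparr>carr := (carr s)(a := (carr s a)(nval i s := cval e s))\<rparr>) \<Longrightarrow> halts (CStore a i e) 1 s Q"
  unfolding halts_def using exec.CStore by blast

lemma halts_Seq:
  "halts c T s P \<Longrightarrow> (\<And>s'. P s' \<Longrightarrow> halts d U s' Q) \<Longrightarrow> halts (Seq c d) (T + U) s Q"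
  unfolding halts_def by (meson exec.Seq add_mono)

text \<open>The intermediate assertion is taken to be the requirement of the second program, so
  repeated rule application executes straight-line code symbolically.\<close>

lemma halts_Seq_wp: "halts c T s (\<lambda>s'. halts d U s' Q) \<Longrightarrow> halts (Seq c d) (T + U) s Q"
  by (rule halts_Seq)

lemma halts_Cond:
  assumes "holds b s \<Longrightarrow> halts c T s Q" "\<not> holds b s \<Longrightarrow> halts d T s Q"
  shows "halts (Cond b c d) (Suc T) s Q"
proof (cases "holds b s")
  case True
  with assms show ?thesis unfolding halts_def
    by (metis exec.CondT Suc_le_mono plus_1_eq_Suc)
next
  case False
  with assms show ?thesis unfolding halts_def
    by (metis exec.CondF Suc_le_mono plus_1_eq_Suc)
qed

lemma halts_While_False: "\<not> holds b s \<Longrightarrow> Q s \<Longrightarrow> halts (While b c) (Suc T) s Q"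
  unfolding halts_def using exec.WhileF[of b s c] by fastforce

text \<open>At most \<open>N\<close> rounds are possible, each costing \<open>T\<close> and one
  test; the final 1 is the failing test.\<close>

lemma halts_While:
  assumes "I s"
    and step: "\<And>s. I s \<Longrightarrow> holds b s \<Longrightarrow> halts c T s (\<lambda>s'. I s' \<and> V s' < V s)"
    and post: "\<And>s. I s \<Longrightarrow> \<not> holds b s \<Longrightarrow> Q s"
    and V: "V s \<le> N"
  shows "halts (While b c) (N * Suc T + 1) s Q"
  using assms(1) V
proof (induction N arbitrary: s)
  case 0
  then have "\<not> holds b s" using step[of s] by (auto simp: halts_def)
  then show ?case using halts_While_False[OF _ post] 0 by simp
next
  case (Suc N)
  show ?case
  proof (cases "holds b s")
    case True
    then obtain t s' where t: "exec c s t s'" "t \<le> T" "I s'" "V s' < V s"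
      using step[OF Suc.prems(1)] by (auto simp: halts_def)
    then obtain u s'' where u: "exec (While b c) s' u s''" "u \<le> N * Suc T + 1" "Q s''"
      using Suc.IH[of s'] Suc.prems(2) unfolding halts_def by auto
    have "exec (While b c) s (1 + t + u) s''" using True t(1) u(1) by (rule exec.WhileT)
    moreover have "1 + t + u \<le> Suc N * Suc T + 1" using t(2) u(2) by simp
    ultimately show ?thesis using u(3) unfolding halts_def by blast
  next
    case False
    then show ?thesis using halts_While_False[OF _ post] Suc.prems by (simp del: mult_Suc_right)
  qed
qed

lemma halts_time: "halts c T s Q \<Longrightarrow> T \<le> U \<Longrightarrow> halts c U s Q"
  using halts_mono by blast

abbreviation seq_infix :: "com \<Rightarrow> com \<Rightarrow> com" (infixr ";;" 60) where
  "c ;; d \<equiv> Seq c d"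

lemma seq_NStore:
  "halts d T (s\<lparr>narr := (narr s)(a := (narr s a)(nval i s := nval e s))\<rparr>) Q \<Longrightarrow>
    halts (NStore a i e ;; d) (1 + T) s Q"
  by (intro halts_Seq_wp halts_NStore)

lemma seq_NAssign:
  "halts d T (s\<lparr>nreg := (nreg s)(i := nval e s)\<rparr>) Q \<Longrightarrow> halts (NAssign i e ;; d) (1 + T) s Q"
  by (intro halts_Seq_wp halts_NAssign)

section \<open>Labelled nodes of the recursion tree\<close>

locale numbered_graph = bounded_degree_graph G \<Delta> q w
  for G :: "('v, 'e) multigraph" and \<Delta> q w +
  fixes n m :: nat and x y :: "nat \<Rightarrow> nat" and f :: "nat \<Rightarrow> 'v" and g :: "nat \<Rightarrow> 'e"
  assumes f: "bij_betw f {..<n} (verts G)" and g: "bij_betw g {..<m} (edges G)"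
    and ends_g: "j < m \<Longrightarrow> x j < n \<and> y j < n \<and> ends G (g j) = {f (x j), f (y j)}"
begin

abbreviation "\<nu> \<equiv> inv_into {..<n} f"
abbreviation "\<gamma> \<equiv> inv_into {..<m} g"

lemma f_verts [simp]: "i < n \<Longrightarrow> f i \<in> verts G"
  and \<nu>_f [simp]: "i < n \<Longrightarrow> \<nu> (f i) = i"
  using f by (auto simp: bij_betw_def)

lemma g_edges [simp]: "j < m \<Longrightarrow> g j \<in> edges G"
  and \<gamma>_g [simp]: "j < m \<Longrightarrow> \<gamma> (g j) = j"
  using g by (auto simp: bij_betw_def)

lemma vert_cases: "v \<in> verts G \<Longrightarrow> (\<And>i. i < n \<Longrightarrow> v = f i \<Longrightarrow> P) \<Longrightarrow> P"
  using f by (auto simp: bij_betw_def)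

lemma edge_cases: "e \<in> edges G \<Longrightarrow> (\<And>j. j < m \<Longrightarrow> e = g j \<Longrightarrow> P) \<Longrightarrow> P"
  using g by (auto simp: bij_betw_def)

lemma f_eq_iff [simp]: "i < n \<Longrightarrow> j < n \<Longrightarrow> f i = f j \<longleftrightarrow> i = j"
  using \<nu>_f by metis

lemma g_eq_iff [simp]: "i < m \<Longrightarrow> j < m \<Longrightarrow> g i = g j \<longleftrightarrow> i = j"
  using \<gamma>_g by metis

lemma x_less [simp]: "j < m \<Longrightarrow> x j < n" and y_less [simp]: "j < m \<Longrightarrow> y j < n"
  using ends_g by auto

lemma ends_neq [simp]:
  assumes "j < m"
  shows "x j \<noteq> n + k" "n + k \<noteq> x j" "y j \<noteq> n + k" "n + k \<noteq> y j"
  using x_less[OF assms] y_less[OF assms] by linarith+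

lemma x_neq_y: "j < m \<Longrightarrow> x j \<noteq> y j"
proof
  assume "j < m" "x j = y j"
  then have "card (ends G (g j)) = 1" using ends_g by simp
  then show False using card_ends[of "g j"] \<open>j < m\<close> by simp
qed

text \<open>
  A node of the recursion tree is stored as a labelling of \<open>n + m\<close> cells: vertex \<open>f i\<close> has its label in
  cell \<open>i\<close> (0 if it lies in \<open>F\<close>, 1 if it lies in \<open>S\<close>, at least 3 if it has been removed) and edge \<open>g j\<close> in
  cell \<open>n + j\<close> (0, or at least 3 if it has been deleted). Then an edge can be used by the recursion iff
  the three labels of the edge and its ends add up to 1 (a branch) or 2 (a loop).
\<close>

definition free :: "(nat \<Rightarrow> nat) \<Rightarrow> 'v set" where
  "free l = f ` {i. i < n \<and> l i = 0}"

definition comp :: "(nat \<Rightarrow> nat) \<Rightarrow> 'v set" where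
  "comp l = f ` {i. i < n \<and> l i = 1}"

text \<open>An edge at a removed vertex is dead even if its own cell holds 0. Removing a vertex
  therefore needs no update of edge cells.\<close>

definition live :: "(nat \<Rightarrow> nat) \<Rightarrow> 'e set" where
  "live l = g ` {j. j < m \<and> l (n + j) = 0 \<and> l (x j) \<le> 1 \<and> l (y j) \<le> 1}"

lemma f_free: "i < n \<Longrightarrow> f i \<in> free l \<longleftrightarrow> l i = 0"
  and f_comp: "i < n \<Longrightarrow> f i \<in> comp l \<longleftrightarrow> l i = 1"
  and g_live: "j < m \<Longrightarrow> g j \<in> live l \<longleftrightarrow> l (n + j) = 0 \<and> l (x j) \<le> 1 \<and> l (y j) \<le> 1"
  by (auto simp: free_def comp_def live_def)

lemma vert_set_eqI:
  assumes "A \<subseteq> verts G" "B \<subseteq> verts G" "\<And>i. i < n \<Longrightarrow> f i \<in> A \<longleftrightarrow> f i \<in> B"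
  shows "A = B"
proof (rule set_eqI)
  fix v show "v \<in> A \<longleftrightarrow> v \<in> B"
    using assms by (cases "v \<in> verts G") (auto elim: vert_cases)
qed

lemma edge_set_eqI:
  assumes "A \<subseteq> edges G" "B \<subseteq> edges G" "\<And>j. j < m \<Longrightarrow> g j \<in> A \<longleftrightarrow> g j \<in> B"
  shows "A = B"
proof (rule set_eqI)
  fix e show "e \<in> A \<longleftrightarrow> e \<in> B"
    using assms by (cases "e \<in> edges G") (auto elim: edge_cases)
qed

lemma free_verts: "free l \<subseteq> verts G" and comp_verts: "comp l \<subseteq> verts G"
  and live_edges: "live l \<subseteq> edges G"
  by (auto simp: free_def comp_def live_def)

lemma config_labels: "config (free l) (comp l) (live l)"
proof -
  have "free l \<inter> comp l = {}" by (auto simp: free_def comp_def)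
  moreover have "ends G e \<subseteq> free l \<union> comp l" if "e \<in> live l" for e
    using that ends_g by (auto simp: live_def f_free f_comp le_Suc_eq)
  ultimately show ?thesis
    using free_verts comp_verts live_edges by (auto simp: config_def)
qed

text \<open>Blocks lie in one common array, so a labelling read from it is meaningful only on its
  \<open>n + m\<close> cells.\<close>

lemma labels_cong:
  assumes "\<And>j. j < n + m \<Longrightarrow> l j = l' j"
  shows "free l = free l'" "comp l = comp l'" "live l = live l'"
proof -
  show "free l = free l'" "comp l = comp l'"
    using assms by (auto simp: free_def comp_def)
  have "{j. j < m \<and> l (n + j) = 0 \<and> l (x j) \<le> 1 \<and> l (y j) \<le> 1} =
      {j. j < m \<and> l' (n + j) = 0 \<and> l' (x j) \<le> 1 \<and> l' (y j) \<le> 1}"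
    using assms x_less y_less by (auto simp: trans_less_add1)
  then show "live l = live l'" by (simp add: live_def)
qed

text \<open>Guards the decoding of a label sum: a single cell holding 2 would imitate a loop, and an
  edge cell holding 1 could imitate a merged end.\<close>

definition good :: "(nat \<Rightarrow> nat) \<Rightarrow> bool" where
  "good l \<longleftrightarrow> (\<forall>i<n. l i \<noteq> 2) \<and> (\<forall>j<m. l (n + j) \<noteq> 1 \<and> l (n + j) \<noteq> 2)"

lemma good_cong: "(\<And>j. j < n + m \<Longrightarrow> l j = l' j) \<Longrightarrow> good l \<longleftrightarrow> good l'"
  by (simp add: good_def)

definition kind :: "(nat \<Rightarrow> nat) \<Rightarrow> nat \<Rightarrow> nat" where
  "kind l e = l (x e) + l (y e) + l (n + e)"

definition child1 :: "(nat \<Rightarrow> nat) \<Rightarrow> nat \<Rightarrow> nat \<Rightarrow> nat" where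
  "child1 l e = l(n + e := 3)"

definition child2 :: "(nat \<Rightarrow> nat) \<Rightarrow> nat \<Rightarrow> nat \<Rightarrow> nat" where
  "child2 l e = l(n + e := 3, x e := 1, y e := 1)"

text \<open>Tripling turns the label 1 into 3 and thus removes \<open>S\<close>; an end of \<open>e\<close> with label 0 becomes the new \<open>S\<close>.\<close>

definition child3 :: "(nat \<Rightarrow> nat) \<Rightarrow> nat \<Rightarrow> nat \<Rightarrow> nat" where
  "child3 l e = (\<lambda>j. 3 * l j)(x e := 3 * l (x e) + (1 - l (x e)), y e := 3 * l (y e) + (1 - l (y e)))"

lemma good_children:
  assumes "good l" "e < m"
  shows "good (child1 l e)" "good (child2 l e)" "good (child3 l e)"
proof -
  show "good (child1 l e)" "good (child2 l e)"
    using assms x_less[OF assms(2)] y_less[OF assms(2)] by (auto simp: good_def child1_def child2_def)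
  have "3 * k + (1 - k) \<noteq> 2" "3 * k \<noteq> 1" "3 * k \<noteq> 2" for k :: nat
    by presburger+
  then show "good (child3 l e)"
    using x_less[OF assms(2)] y_less[OF assms(2)] by (auto simp: good_def child3_def)
qed

lemma no_active_edge:
  assumes "\<And>e. e < m \<Longrightarrow> \<not> (0 < kind l e \<and> kind l e < 3)"
  shows "\<forall>e\<in>live l. ends G e \<inter> comp l = {}"
proof
  fix e assume "e \<in> live l"
  then obtain j where j: "j < m" "e = g j" "l (n + j) = 0" "l (x j) \<le> 1" "l (y j) \<le> 1"
    by (auto simp: live_def)
  then have "l (x j) = 0" "l (y j) = 0" using assms[OF j(1)] by (auto simp: kind_def)
  then show "ends G e \<inter> comp l = {}"
    using j ends_g[OF j(1)] by (auto simp: f_comp)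
qed

lemma child1_config:
  assumes "e < m"
  shows "free (child1 l e) = free l" "comp (child1 l e) = comp l" "live (child1 l e) = live l - {g e}"
proof -
  show "free (child1 l e) = free l" "comp (child1 l e) = comp l"
    by (auto simp: free_def comp_def child1_def)
  show "live (child1 l e) = live l - {g e}"
    using live_edges assms
    by (intro edge_set_eqI) (auto simp: g_live child1_def)
qed

lemma kind_1_cases:
  assumes "good l" "e < m" "kind l e = 1"
  obtains s u where "s < n" "u < n" "s \<noteq> u" "{x e, y e} = {s, u}" "l s = 1" "l u = 0" "l (n + e) = 0"
proof -
  have "l (n + e) = 0" using assms by (auto simp: good_def kind_def)
  then show ?thesis using that[of "x e" "y e"] that[of "y e" "x e"] assms x_neq_y[OF assms(2)]
    by (auto simp: kind_def add_is_1)
qed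

lemma kind_2:
  assumes "good l" "e < m" "kind l e = 2"
  shows "l (x e) = 1" "l (y e) = 1" "l (n + e) = 0"
proof -
  have "l (n + e) = 0" "l (x e) \<noteq> 2" "l (y e) \<noteq> 2"
    using assms x_less y_less by (auto simp: good_def kind_def)
  then show "l (x e) = 1" "l (y e) = 1" "l (n + e) = 0"
    using assms(3) by (auto simp: kind_def)
qed

lemma contract_config:
  assumes "good l" "e < m" "kind l e = 1"
    and su: "s < n" "u < n" "s \<noteq> u" "{x e, y e} = {s, u}" "l s = 1" "l u = 0" "l (n + e) = 0"
  shows "free (child2 l e) = free l - {f u}" "comp (child2 l e) = insert (f u) (comp l)"
    "live (child2 l e) = live l - {g e}"
    "free (child3 l e) = free l - {f u}" "comp (child3 l e) = {f u}"
    "live (child3 l e) = induced (free l) (live l)"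
proof -
  \<comment> \<open>One end has label 1 and the other 0, so apart from the deletion of
    \<open>e\<close> or the tripling the symmetric updates change only the cell of
    \<open>u\<close>.\<close>
  have c2: "child2 l e = l(n + e := 3, u := 1)"
    using su(3-5) assms(2) by (auto simp: child2_def doubleton_eq_iff fun_eq_iff)
  have c3: "child3 l e = (\<lambda>j. 3 * l j)(u := 1)"
    using su(3-6) by (auto simp: child3_def doubleton_eq_iff fun_eq_iff)
  have ne: "\<And>j. j < m \<Longrightarrow> n + j \<noteq> u" "\<And>j i. i < n \<Longrightarrow> i \<noteq> n + j" using su(2) by auto
  have ends_free: "ends G (g j) \<subseteq> free l \<longleftrightarrow> l (x j) = 0 \<and> l (y j) = 0" if "j < m" for j
    using that ends_g by (auto simp: f_free)
  show "free (child2 l e) = free l - {f u}" "free (child3 l e) = free l - {f u}"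
    using su(2) free_verts ne(2) by (intro vert_set_eqI; auto simp: f_free c2 c3)+
  show "comp (child2 l e) = insert (f u) (comp l)" "comp (child3 l e) = {f u}"
    using su(2) comp_verts ne(2) by (intro vert_set_eqI; auto simp: f_comp c2 c3; presburger)+
  show "live (child2 l e) = live l - {g e}"
    using assms(2) su live_edges ne by (intro edge_set_eqI; auto simp: g_live c2)
  show "live (child3 l e) = induced (free l) (live l)"
    using assms(2) su live_edges ne
    by (intro edge_set_eqI) (auto simp: g_live c3 induced_def ends_free)
qed

abbreviation node_value :: "nat \<Rightarrow> (nat \<Rightarrow> nat) \<Rightarrow> complex \<Rightarrow> bool" where
  "node_value b l \<equiv> approx b (free l) (comp l) (live l)"

text \<open>One rule serves both kinds of expanded node, so that every such node has three children
  at consecutive positions.\<close>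

lemma node_value_children:
  assumes "good l" "e < m" "0 < kind l e" "kind l e < 3" "0 < b"
    and z: "node_value b (child1 l e) z1" "node_value (b - 1) (child2 l e) z2"
      "node_value (b - 1) (child3 l e) z3"
  shows "node_value b l (if kind l e < 2 then z1 + w / q * z2 / z3 else (1 + w) * z1)"
proof (cases "kind l e = 1")
  case True
  then obtain s u where su: "s < n" "u < n" "s \<noteq> u" "{x e, y e} = {s, u}" "l s = 1" "l u = 0" "l (n + e) = 0"
    using kind_1_cases assms(1,2) by metis
  note c = contract_config[OF assms(1,2) True su]
  have "ends G (g e) = {f s, f u}"
    using ends_g[OF assms(2)] su(4) by (auto simp: doubleton_eq_iff)
  moreover have "g e \<in> live l" "f s \<in> comp l" "f u \<in> free l"
    using su assms(2) by (auto simp: g_live f_comp f_free doubleton_eq_iff)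
  ultimately have "approx (Suc (b - 1)) (free l) (comp l) (live l) (z1 + w / q * z2 / z3)"
    using z assms(5) by (intro approx.branch[of "g e" "live l" "f s" "f u"])
      (simp_all add: c child1_config[OF assms(2)])
  then show ?thesis using True assms(5) by simp
next
  case False
  then have k: "kind l e = 2" using assms(3,4) by simp
  note k2 = kind_2[OF assms(1,2) k]
  have "approx b (free l) (comp l) (live l) ((1 + w) * z1)"
    using z(1) assms(2) k2 ends_g[OF assms(2)]
    by (intro approx.loop[of "g e" "live l" "f (x e)" "f (y e)"])
      (simp_all add: g_live f_comp child1_config[OF assms(2)])
  then show ?thesis using k by simp
qed

text \<open>Bounds the size of the recursion tree below a node.\<close>

definition potential :: "nat \<Rightarrow> (nat \<Rightarrow> nat) \<Rightarrow> nat" where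
  "potential b l = 2 ^ (active (comp l) (live l) + (\<Delta> + 2) * b)"

lemma potential_pos: "1 \<le> potential b l"
  by (simp add: potential_def)

text \<open>If \<open>P\<close> bounds the potential of a child with reduced budget, the first child
  has 4 \<open>P\<close> and the node 8 \<open>P\<close>, which leaves room for 1 and two further
  \<open>P\<close>. A unit of budget contributes \<open>\<Delta> + 2\<close> to the exponent:
  \<Delta> for the edges that a contraction activates, 2 for this slack.\<close>

lemma potential_children:
  assumes "good l" "e < m" "0 < kind l e" "kind l e < 3" "0 < b"
  shows "1 + potential b (child1 l e) + potential (b - 1) (child2 l e) + potential (b - 1) (child3 l e)
    \<le> potential b l"
proof -
  let ?a = "active (comp l) (live l - {g e})"
  have fin: "finite (live l)" using config_finite[OF config_labels] by blast
  have "active (comp l) (live l) = Suc ?a \<and>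
    active (comp (child2 l e)) (live (child2 l e)) \<le> ?a + \<Delta> \<and>
    active (comp (child3 l e)) (live (child3 l e)) \<le> \<Delta>"
  proof (cases "kind l e = 1")
    case True
    then obtain s u where su: "s < n" "u < n" "s \<noteq> u" "{x e, y e} = {s, u}" "l s = 1" "l u = 0" "l (n + e) = 0"
      using kind_1_cases assms(1,2) by metis
    note c = contract_config[OF assms(1,2) True su]
    have "g e \<in> live l" "f s \<in> comp l" "f s \<in> ends G (g e)"
      using su assms(2) ends_g[OF assms(2)] by (auto simp: g_live f_comp doubleton_eq_iff)
    then have "active (comp l) (live l) = Suc ?a"
      using active_delete[OF fin] by blast
    moreover have "active (insert (f u) (comp l)) (live l - {g e}) \<le> ?a + \<Delta>"
      using live_edges su(2) by (intro active_contract) auto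
    moreover have "active {f u} (induced (free l) (live l)) \<le> \<Delta>"
      using live_edges su(2) by (intro active_singleton) (auto simp: induced_def)
    ultimately show ?thesis by (simp add: c)
  next
    case False
    then have k: "kind l e = 2" using assms(3,4) by simp
    note k2 = kind_2[OF assms(1,2) k]
    have "g e \<in> live l" "f (x e) \<in> comp l" "f (x e) \<in> ends G (g e)"
      using k2 assms(2) ends_g[OF assms(2)] by (auto simp: g_live f_comp)
    then have "active (comp l) (live l) = Suc ?a"
      using active_delete[OF fin] by blast
    \<comment> \<open>The same inequality is needed at a loop node: the second child then has the
      labels of the first, and tripling leaves the third with an empty merged set.\<close>
    moreover have "child2 l e = child1 l e"
      using k2 by (auto simp: child1_def child2_def fun_eq_iff)
    then have "active (comp (child2 l e)) (live (child2 l e)) = ?a"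
      by (simp add: child1_config[OF assms(2)])
    moreover have "child3 l e i \<noteq> 1" for i
    proof -
      have "3 * k \<noteq> 1" for k :: nat by presburger
      then show ?thesis using k2 by (auto simp: child3_def)
    qed
    then have "comp (child3 l e) = {}" by (auto simp: comp_def)
    then have "active (comp (child3 l e)) (live (child3 l e)) = 0"
      by (simp add: active_def)
    ultimately show ?thesis by simp
  qed
  then have a: "active (comp l) (live l) = Suc ?a"
    and a2: "active (comp (child2 l e)) (live (child2 l e)) \<le> ?a + \<Delta>"
    and a3: "active (comp (child3 l e)) (live (child3 l e)) \<le> ?a + \<Delta>" by auto
  obtain b' where b: "b = Suc b'" using assms(5) by (cases b) auto
  let ?P = "2 ^ (?a + \<Delta> + (\<Delta> + 2) * b') :: nat"
  have "potential (b - 1) (child2 l e) \<le> ?P" "potential (b - 1) (child3 l e) \<le> ?P"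
    unfolding potential_def using a2 a3 b by (auto intro!: power_increasing)
  moreover have "potential b (child1 l e) = 4 * ?P"
  proof -
    have "?a + (\<Delta> + 2) * b = 2 + (?a + \<Delta> + (\<Delta> + 2) * b')" by (simp add: b)
    then show ?thesis unfolding potential_def child1_config[OF assms(2)] by (simp only: power_add) simp
  qed
  moreover have "potential b l = 2 * potential b (child1 l e)"
    unfolding potential_def child1_config[OF assms(2)] a by simp
  moreover have "1 \<le> ?P" by simp
  ultimately show ?thesis by linarith
qed

text \<open>The node of the \<open>i\<close>-th factor of the telescoping product. For
  \<open>i < n\<close> all edge cells hold 0, edges at earlier vertices being excluded through their
  ends.\<close>

definition root :: "nat \<Rightarrow> nat \<Rightarrow> nat" where
  "root i j = (if j < i then 3 else if j = i then 1 else 0)"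

lemma root_config:
  assumes "i < n"
  shows "good (root i)" "free (root i) = f ` {Suc i..<n}" "comp (root i) = {f i}"
    "live (root i) = induced (f ` {i..<n}) (edges G)"
proof -
  show "good (root i)" using assms by (auto simp: good_def root_def)
  show "free (root i) = f ` {Suc i..<n}" by (auto simp: free_def root_def)
  show "comp (root i) = {f i}" using assms by (auto simp: comp_def root_def)
  have 1: "f k \<in> f ` {i..<n} \<longleftrightarrow> i \<le> k" if "k < n" for k
    using that by (auto simp: image_iff)
  have "ends G (g j) \<subseteq> f ` {i..<n} \<longleftrightarrow> i \<le> x j \<and> i \<le> y j" if "j < m" for j
    using ends_g[OF that] 1 by auto
  then show "live (root i) = induced (f ` {i..<n}) (edges G)"
    using assms live_edges by (intro edge_set_eqI) (auto simp: g_live induced_def root_def)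
qed

lemma potential_root:
  assumes "i < n"
  shows "potential b (root i) \<le> 2 ^ (\<Delta> + (\<Delta> + 2) * b)"
proof -
  have "active (comp (root i)) (live (root i)) \<le> \<Delta>"
    unfolding root_config(3)[OF assms] using assms live_edges by (intro active_singleton) auto
  then show ?thesis unfolding potential_def by (intro power_increasing) auto
qed

section \<open>The queue of nodes and its invariant\<close>

abbreviation "L \<equiv> n + m"

definition block :: "(nat \<Rightarrow> nat) \<Rightarrow> nat \<Rightarrow> nat \<Rightarrow> nat" where
  "block A i j = A (i * L + j)"

definition combine :: "nat \<Rightarrow> complex \<Rightarrow> complex \<Rightarrow> complex \<Rightarrow> complex" where
  "combine k z1 z2 z3 = (if k < 2 then z1 + w / q * z2 / z3 else (1 + w) * z1)"

abbreviation slot_value :: "(nat \<Rightarrow> nat) \<Rightarrow> (nat \<Rightarrow> nat) \<Rightarrow> nat \<Rightarrow> complex \<Rightarrow> bool" where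
  "slot_value A bud i \<equiv> node_value (bud i) (block A i)"

text \<open>Children are evaluated only later, so the relation is promised for all values they may
  obtain. The index 0 can mark a leaf because children come after their parent, and
  \<open>i < ch i\<close> is what permits evaluation from the end.\<close>

definition slot_done where
  "slot_done A bud ch kd cnt i \<longleftrightarrow>
    (if ch i = 0 then slot_value A bud i 1
     else i < ch i \<and> ch i + 2 < cnt \<and>
       (\<forall>z1 z2 z3. slot_value A bud (ch i) z1 \<longrightarrow> slot_value A bud (ch i + 1) z2 \<longrightarrow>
          slot_value A bud (ch i + 2) z3 \<longrightarrow> slot_value A bud i (combine (kd i) z1 z2 z3)))"

text \<open>The last conjunct is amortised: processed nodes plus the potential of pending ones stay
  within \<open>N\<close>, which bounds the whole forest in advance. As \<open>ch\<close> is still 0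
  from \<open>cur\<close> on, a leaf needs no write.\<close>

definition queue where
  "queue N b0 A bud ch kd cur cnt \<longleftrightarrow>
     n \<le> cnt \<and> cur \<le> cnt \<and>
     (\<forall>i<n. \<forall>j<L. block A i j = root i j) \<and> (\<forall>i<n. bud i = b0) \<and>
     (\<forall>i<cnt. good (block A i)) \<and>
     (\<forall>i\<ge>cur. ch i = 0) \<and>
     (\<forall>i<cur. slot_done A bud ch kd cnt i) \<and>
     cur + (\<Sum>i=cur..<cnt. potential (bud i) (block A i)) \<le> N"

lemma queue_cnt_le:
  assumes "queue N b0 A bud ch kd cur cnt"
  shows "cnt \<le> N"
proof -
  have "(\<Sum>i=cur..<cnt. 1) \<le> (\<Sum>i=cur..<cnt. potential (bud i) (block A i))"
    by (intro sum_mono potential_pos)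
  then show ?thesis using assms by (auto simp: queue_def)
qed

lemma queue_leaf:
  assumes "queue N b0 A bud ch kd cur cnt" "cur < cnt"
    and leaf: "bud cur = 0 \<or> (\<forall>e<m. \<not> (0 < kind (block A cur) e \<and> kind (block A cur) e < 3))"
  shows "queue N b0 A bud ch kd (Suc cur) cnt"
proof -
  have "slot_value A bud cur 1"
    using leaf no_active_edge[of "block A cur"] by (auto intro!: approx.leaf)
  then have "slot_done A bud ch kd cnt cur"
    using assms by (simp add: queue_def slot_done_def)
  moreover have "Suc cur + (\<Sum>i=Suc cur..<cnt. potential (bud i) (block A i))
      \<le> cur + (\<Sum>i=cur..<cnt. potential (bud i) (block A i))"
    using assms(2) potential_pos[of "bud cur" "block A cur"] by (simp add: sum.atLeast_Suc_lessThan)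
  ultimately show ?thesis
    using assms by (auto simp: queue_def less_Suc_eq simp del: sum.atLeast_Suc_lessThan)
qed

lemma slot_cong:
  assumes "\<And>j. j < L \<Longrightarrow> block A i j = l j"
  shows "slot_value A bud i = node_value (bud i) l" "potential b (block A i) = potential b l"
    "good (block A i) = good l"
  using labels_cong[of "block A i" l] good_cong[of "block A i" l] assms
  by (simp_all add: potential_def)

text \<open>New blocks are written behind all existing ones, so statements about finished nodes
  survive. The potential of the expanded node pays for its children and for advancing
  \<open>cur\<close>.\<close>

lemma queue_expand:
  assumes Q: "queue N b0 A bud ch kd cur cnt" and cur: "cur < cnt" and e: "e < m"
    and k: "0 < kind (block A cur) e" "kind (block A cur) e < 3" and bud: "0 < bud cur"
    and old: "\<And>i. i < cnt * L \<Longrightarrow> A' i = A i"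
    and new1: "\<And>j. j < L \<Longrightarrow> block A' cnt j = child1 (block A cur) e j"
    and new2: "\<And>j. j < L \<Longrightarrow> block A' (cnt + 1) j = child2 (block A cur) e j"
    and new3: "\<And>j. j < L \<Longrightarrow> block A' (cnt + 2) j = child3 (block A cur) e j"
    and bud': "bud' = bud(cnt := bud cur, cnt + 1 := bud cur - 1, cnt + 2 := bud cur - 1)"
  shows "queue N b0 A' bud' (ch(cur := cnt)) (kd(cur := kind (block A cur) e)) (Suc cur) (cnt + 3)"
proof -
  let ?l = "block A cur"
  note q = Q[unfolded queue_def]
  have good: "good ?l" using q cur by blast
  have blk: "block A' i j = block A i j" if "i < cnt" "j < L" for i j
  proof -
    have "i * L + j < Suc i * L" using that by simp
    also have "\<dots> \<le> cnt * L" using that by (intro mult_le_mono1) simp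
    finally show ?thesis using old by (simp add: block_def)
  qed
  have old_bud: "bud' i = bud i" if "i < cnt" for i using that by (simp add: bud')
  have sv: "slot_value A' bud' i = slot_value A bud i" if "i < cnt" for i
    using slot_cong(1)[of A' i "block A i"] blk[OF that] old_bud[OF that] by simp
  have sv1: "slot_value A' bud' cnt = node_value (bud cur) (child1 ?l e)"
    using slot_cong(1)[OF new1] by (simp add: bud')
  have sv2: "slot_value A' bud' (cnt + 1) = node_value (bud cur - 1) (child2 ?l e)"
    using slot_cong(1)[OF new2] by (simp add: bud')
  have sv3: "slot_value A' bud' (cnt + 2) = node_value (bud cur - 1) (child3 ?l e)"
    using slot_cong(1)[OF new3] by (simp add: bud')
  have done_old: "slot_done A' bud' (ch(cur := cnt)) (kd(cur := kind ?l e)) (cnt + 3) i" if i: "i < cur" for i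
  proof (cases "ch i = 0")
    case True
    then show ?thesis using q i cur sv[of i] unfolding slot_done_def by auto
  next
    case False
    have "slot_done A bud ch kd cnt i" using q i by blast
    then show ?thesis using False i cur sv[of i] sv[of "ch i"] sv[of "ch i + 1"] sv[of "ch i + 2"]
      unfolding slot_done_def by simp
  qed
  have done_new: "slot_done A' bud' (ch(cur := cnt)) (kd(cur := kind ?l e)) (cnt + 3) cur"
    using node_value_children[OF good e k bud] cur
    unfolding slot_done_def combine_def by (simp add: sv[OF cur] sv1 sv2[simplified] sv3[simplified])
  have goods: "good (block A' i)" if i: "i < cnt + 3" for i
  proof -
    consider "i < cnt" | "i = cnt" | "i = cnt + 1" | "i = cnt + 2" using i by linarith
    then show ?thesis
    proof cases
      case 1
      then show ?thesis using q slot_cong(3)[of A' i "block A i"] blk by blast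
    qed (use good_children[OF good e] slot_cong(3)[OF new1] slot_cong(3)[OF new2] slot_cong(3)[OF new3] in auto)
  qed
  have sum_new: "(\<Sum>i=Suc cur..<cnt + 3. potential (bud' i) (block A' i)) =
      (\<Sum>i=Suc cur..<cnt. potential (bud' i) (block A' i)) + potential (bud' cnt) (block A' cnt)
      + potential (bud' (cnt + 1)) (block A' (cnt + 1)) + potential (bud' (cnt + 2)) (block A' (cnt + 2))"
    using cur by (simp add: numeral_3_eq_3)
  have sum_old: "(\<Sum>i=Suc cur..<cnt. potential (bud' i) (block A' i)) = (\<Sum>i=Suc cur..<cnt. potential (bud i) (block A i))"
  proof (rule sum.cong[OF refl])
    fix i assume "i \<in> {Suc cur..<cnt}"
    then have "i < cnt" by simp
    then show "potential (bud' i) (block A' i) = potential (bud i) (block A i)"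
      using slot_cong(2)[of A' i "block A i"] blk old_bud by simp
  qed
  have "potential (bud' cnt) (block A' cnt) = potential (bud cur) (child1 ?l e)"
    "potential (bud' (cnt + 1)) (block A' (cnt + 1)) = potential (bud cur - 1) (child2 ?l e)"
    "potential (bud' (cnt + 2)) (block A' (cnt + 2)) = potential (bud cur - 1) (child3 ?l e)"
    using slot_cong(2)[OF new1] slot_cong(2)[OF new2] slot_cong(2)[OF new3] by (simp_all add: bud')
  moreover have "(\<Sum>i=cur..<cnt. potential (bud i) (block A i)) =
      potential (bud cur) ?l + (\<Sum>i=Suc cur..<cnt. potential (bud i) (block A i))"
    using cur by (rule sum.atLeast_Suc_lessThan)
  ultimately have pot: "Suc cur + (\<Sum>i=Suc cur..<cnt + 3. potential (bud' i) (block A' i)) \<le> N"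
    using potential_children[OF good e k bud] q sum_new sum_old by linarith
  show ?thesis
    unfolding queue_def
  proof (intro conjI allI impI)
    show "\<And>i j. i < n \<Longrightarrow> j < L \<Longrightarrow> block A' i j = root i j" "\<And>i. i < n \<Longrightarrow> bud' i = b0"
      using q blk old_bud by auto
    show "\<And>i. Suc cur \<le> i \<Longrightarrow> (ch(cur := cnt)) i = 0" using q by auto
    show "\<And>i. i < Suc cur \<Longrightarrow> slot_done A' bud' (ch(cur := cnt)) (kd(cur := kind ?l e)) (cnt + 3) i"
      using done_old done_new less_Suc_eq by blast
  qed (use q cur goods pot in auto)
qed

definition valued where
  "valued A bud cnt cur v \<longleftrightarrow> (\<forall>i. cur \<le> i \<and> i < cnt \<longrightarrow> slot_value A bud i (v i))"

text \<open>Children have larger indices than their parent, so their values are available when the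
  backward sweep reaches it.\<close>

lemma valued_step:
  assumes "queue N b0 A bud ch kd cnt cnt" "valued A bud cnt (Suc cur) v" "cur < cnt"
    and "z = (if ch cur = 0 then 1 else combine (kd cur) (v (ch cur)) (v (ch cur + 1)) (v (ch cur + 2)))"
  shows "valued A bud cnt cur (v(cur := z))"
proof -
  have "slot_done A bud ch kd cnt cur" using assms(1,3) by (simp add: queue_def)
  then have "slot_value A bud cur z"
    using assms(2,4) unfolding slot_done_def valued_def by (cases "ch cur = 0") auto
  then show ?thesis using assms(2) unfolding valued_def
    by (auto simp: Suc_le_eq)
qed

lemma queue_result:
  assumes Q: "queue N b0 A bud ch kd cnt cnt" and v: "valued A bud cnt 0 v"
    and small: "32 * real n * M ^ \<Delta> * (1 / 2) ^ b0 \<le> min 1 \<epsilon>"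
  shows "mult_approx \<epsilon> (q ^ n * (\<Prod>i<n. v i)) (Z_T G q w)"
proof (rule Z_T_approx[OF f _ small])
  fix i assume i: "i < n"
  have "slot_value A bud i (v i)" using v i Q by (auto simp: valued_def queue_def)
  moreover have "slot_value A bud i = node_value b0 (root i)"
    using slot_cong(1)[of A i "root i" bud] Q i by (simp add: queue_def)
  ultimately show "approx b0 (f ` {Suc i..<n}) {f i} (induced (f ` {i..<n}) (edges G)) (v i)"
    by (simp add: root_config[OF i])
qed

lemma queue_init:
  assumes "\<And>i j. i < n \<Longrightarrow> j < L \<Longrightarrow> block A i j = root i j" "\<And>i. i < n \<Longrightarrow> bud i = b0"
  shows "queue (n * 2 ^ (\<Delta> + (\<Delta> + 2) * b0)) b0 A bud (\<lambda>_. 0) kd 0 n"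
proof -
  have c: "good (block A i) = good (root i)" "potential b (block A i) = potential b (root i)" if "i < n" for i b
    using slot_cong[of A i "root i"] assms(1)[OF that] by auto
  have "(\<Sum>i=0..<n. potential (bud i) (block A i)) \<le> (\<Sum>i=0..<n. 2 ^ (\<Delta> + (\<Delta> + 2) * b0))"
    using assms(2) c potential_root by (intro sum_mono) auto
  then show ?thesis using assms c root_config(1) by (simp add: queue_def)
qed

end

text \<open>
  Natural registers: 0 and 1 hold \<open>n\<close> and \<open>m\<close>, 2 the block length \<open>n + m\<close>, 3 the contraction budget,
  4 and 5 the current node and the number of nodes, 6 and 7 the start of their blocks, 8 an edge,
  9 a cell. Natural arrays: 0 and 1 hold the ends of the edges, 2 the blocks of labels, 3 the
  budgets, 4 the first child (0 at a leaf: node 0 is a root), 5 whether the node is a branch (1) or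
  a loop (2). Complex array 0 holds the values of the nodes.
\<close>

definition choose_budget :: "nat \<Rightarrow> com" where
  "choose_budget c =
    Cond (ReLess (COfNat (NLit 1)) (CReg 0)) (CAssign 0 (COfNat (NLit 1))) Skip ;;
    CAssign 3 (CTimes (COfNat (NLit c)) (COfNat (NReg 0))) ;;
    While (ReLess (CReg 0) (CReg 3))
      (CAssign 3 (CDivide (CReg 3) (COfNat (NLit 2))) ;; NAssign 3 (NPlus (NReg 3) (NLit 1)))"

text \<open>The label array is zero initially; a root block therefore only needs 3 at the earlier
  vertices and a single 1.\<close>

definition fill_removed :: com where
  "fill_removed =
    While (NLess (NReg 9) (NReg 5))
      (NStore 2 (NPlus (NReg 7) (NReg 9)) (NLit 3) ;; NAssign 9 (NPlus (NReg 9) (NLit 1)))"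

definition place_roots :: com where
  "place_roots =
    NAssign 2 (NPlus (NReg 0) (NReg 1)) ;;
    While (NLess (NReg 5) (NReg 0))
      (NAssign 9 (NLit 0) ;;
       fill_removed ;;
       NStore 2 (NPlus (NReg 7) (NReg 5)) (NLit 1) ;;
       NStore 3 (NReg 5) (NReg 3) ;;
       NAssign 5 (NPlus (NReg 5) (NLit 1)) ;;
       NAssign 7 (NPlus (NReg 7) (NReg 2)))"

definition kind_exp :: nexp where
  "kind_exp =
    NPlus (NPlus (NArr 2 (NPlus (NReg 6) (NArr 0 (NReg 8)))) (NArr 2 (NPlus (NReg 6) (NArr 1 (NReg 8)))))
      (NArr 2 (NPlus (NReg 6) (NPlus (NReg 0) (NReg 8))))"

definition scan_edges :: com where
  "scan_edges =
    While (TAnd (NLess (NReg 8) (NReg 1))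
        (TNot (TAnd (NLess (NLit 0) kind_exp) (NLess kind_exp (NLit 3)))))
      (NAssign 8 (NPlus (NReg 8) (NLit 1)))"

text \<open>All three children are copied in one pass, the third one tripled by repeated addition
  because the naturals have no multiplication.\<close>

definition copy_block :: com where
  "copy_block =
    While (NLess (NReg 9) (NReg 2))
      (NStore 2 (NPlus (NReg 7) (NReg 9)) (NArr 2 (NPlus (NReg 6) (NReg 9))) ;;
       NStore 2 (NPlus (NPlus (NReg 7) (NReg 2)) (NReg 9)) (NArr 2 (NPlus (NReg 6) (NReg 9))) ;;
       NStore 2 (NPlus (NPlus (NReg 7) (NPlus (NReg 2) (NReg 2))) (NReg 9))
         (NPlus (NArr 2 (NPlus (NReg 6) (NReg 9)))
           (NPlus (NArr 2 (NPlus (NReg 6) (NReg 9))) (NArr 2 (NPlus (NReg 6) (NReg 9))))) ;;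
       NAssign 9 (NPlus (NReg 9) (NLit 1)))"

text \<open>Truncated subtraction makes \<open>1 - l\<close> equal to 1 exactly when
  \<open>l\<close> is 0, which replaces a case distinction on which end lies in the merged
  set.\<close>

definition patch_end :: "nat \<Rightarrow> com" where
  "patch_end a =
    NStore 2 (NPlus (NPlus (NReg 7) (NReg 2)) (NArr a (NReg 8))) (NLit 1) ;;
    NStore 2 (NPlus (NPlus (NReg 7) (NPlus (NReg 2) (NReg 2))) (NArr a (NReg 8)))
      (NPlus (NArr 2 (NPlus (NPlus (NReg 7) (NPlus (NReg 2) (NReg 2))) (NArr a (NReg 8))))
        (NMinus (NLit 1) (NArr 2 (NPlus (NReg 6) (NArr a (NReg 8))))))"

definition make_children :: com where
  "make_children =
    NStore 4 (NReg 4) (NReg 5) ;;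
    NStore 5 (NReg 4) kind_exp ;;
    NAssign 9 (NLit 0) ;;
    copy_block ;;
    NStore 2 (NPlus (NReg 7) (NPlus (NReg 0) (NReg 8))) (NLit 3) ;;
    NStore 2 (NPlus (NPlus (NReg 7) (NReg 2)) (NPlus (NReg 0) (NReg 8))) (NLit 3) ;;
    patch_end 0 ;;
    patch_end 1 ;;
    NStore 3 (NReg 5) (NArr 3 (NReg 4)) ;;
    NStore 3 (NPlus (NReg 5) (NLit 1)) (NMinus (NArr 3 (NReg 4)) (NLit 1)) ;;
    NStore 3 (NPlus (NReg 5) (NLit 2)) (NMinus (NArr 3 (NReg 4)) (NLit 1)) ;;
    NAssign 5 (NPlus (NReg 5) (NLit 3)) ;;
    NAssign 7 (NPlus (NReg 7) (NPlus (NReg 2) (NPlus (NReg 2) (NReg 2))))"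

definition expand_all :: com where
  "expand_all =
    While (NLess (NReg 4) (NReg 5))
      (NAssign 8 (NLit 0) ;;
       scan_edges ;;
       Cond (TAnd (NLess (NReg 8) (NReg 1)) (NLess (NLit 0) (NArr 3 (NReg 4)))) make_children Skip ;;
       NAssign 4 (NPlus (NReg 4) (NLit 1)) ;;
       NAssign 6 (NPlus (NReg 6) (NReg 2)))"

definition evaluate_all :: com where
  "evaluate_all =
    While (NLess (NLit 0) (NReg 4))
      (NAssign 4 (NMinus (NReg 4) (NLit 1)) ;;
       Cond (NLess (NLit 0) (NArr 4 (NReg 4)))
         (Cond (NLess (NArr 5 (NReg 4)) (NLit 2))
           (CStore 0 (NReg 4)
             (CPlus (CArr 0 (NArr 4 (NReg 4)))
               (CDivide (CTimes (CDivide (CReg 2) (CReg 1)) (CArr 0 (NPlus (NArr 4 (NReg 4)) (NLit 1))))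
                 (CArr 0 (NPlus (NArr 4 (NReg 4)) (NLit 2))))))
           (CStore 0 (NReg 4)
             (CTimes (CPlus (COfNat (NLit 1)) (CReg 2)) (CArr 0 (NArr 4 (NReg 4))))))
         (CStore 0 (NReg 4) (COfNat (NLit 1))))"

definition multiply_roots :: com where
  "multiply_roots =
    CAssign 0 (COfNat (NLit 1)) ;;
    While (NLess (NReg 4) (NReg 0))
      (CAssign 0 (CTimes (CTimes (CReg 0) (CReg 1)) (CArr 0 (NReg 4))) ;;
       NAssign 4 (NPlus (NReg 4) (NLit 1)))"

section \<open>Running the loops that write blocks\<close>

lemmas halts_rules = halts_Seq_wp halts_Skip halts_NAssign halts_NStore halts_CAssign halts_CStore

lemma fill_removed:
  assumes "nreg s 9 = 0"
  shows "halts fill_removed (nreg s 5 * 3 + 1) s (\<lambda>s'. s' = s\<lparr>nreg := (nreg s)(9 := nreg s 5),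
    narr := (narr s)(2 := (\<lambda>i. if nreg s 7 \<le> i \<and> i < nreg s 7 + nreg s 5 then 3 else narr s 2 i))\<rparr>)"
proof -
  \<comment> \<open>\<open>S j\<close> is the entire state after \<open>j\<close> rounds. An
    invariant that fixes the state needs no separate frame conditions.\<close>
  define S where "S j = s\<lparr>nreg := (nreg s)(9 := j),
    narr := (narr s)(2 := (\<lambda>i. if nreg s 7 \<le> i \<and> i < nreg s 7 + j then 3 else narr s 2 i))\<rparr>" for j
  have step: "halts (NStore 2 (NPlus (NReg 7) (NReg 9)) (NLit 3) ;; NAssign 9 (NPlus (NReg 9) (NLit 1)))
      2 (S j) (\<lambda>s'. s' = S (Suc j))" for j
    by (rule halts_time, (rule halts_rules)+) (auto simp: S_def fun_eq_iff)
  have 0: "s = S 0" using assms by (cases s) (auto simp: S_def fun_eq_iff)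
  have "halts fill_removed (nreg s 5 * Suc 2 + 1) s (\<lambda>s'. s' = S (nreg s 5))"
    unfolding fill_removed_def
  proof (rule halts_While[where I = "\<lambda>t. \<exists>j\<le>nreg s 5. t = S j" and V = "\<lambda>t. nreg s 5 - nreg t 9"])
    fix t assume t: "\<exists>j\<le>nreg s 5. t = S j" "holds (NLess (NReg 9) (NReg 5)) t"
    then obtain j where j: "t = S j" "j < nreg s 5" by (auto simp: S_def)
    show "halts (NStore 2 (NPlus (NReg 7) (NReg 9)) (NLit 3) ;; NAssign 9 (NPlus (NReg 9) (NLit 1))) 2 t
        (\<lambda>s'. (\<exists>j\<le>nreg s 5. s' = S j) \<and> nreg s 5 - nreg s' 9 < nreg s 5 - nreg t 9)"
      using j by (intro halts_mono[OF step[of j, folded j(1)]]) (auto simp: S_def intro!: exI[of _ "Suc j"])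
  next
    show "\<exists>j\<le>nreg s 5. s = S j" using 0 by blast
  next
    fix t assume "\<exists>j\<le>nreg s 5. t = S j" "\<not> holds (NLess (NReg 9) (NReg 5)) t"
    then show "t = S (nreg s 5)" by (auto simp: S_def)
  qed simp
  then show ?thesis by (simp add: S_def)
qed

text \<open>The array after \<open>k\<close> rounds of the copying loop; \<open>k\<close> cells are
  filled in each of three adjacent zones of length \<open>len\<close>.\<close>

definition copied :: "(nat \<Rightarrow> nat) \<Rightarrow> nat \<Rightarrow> nat \<Rightarrow> nat \<Rightarrow> nat \<Rightarrow> nat \<Rightarrow> nat" where
  "copied A from to len k i =
    (if to \<le> i \<and> i < to + k then A (from + (i - to))
     else if to + len \<le> i \<and> i < to + len + k then A (from + (i - (to + len)))
     else if to + 2 * len \<le> i \<and> i < to + 2 * len + k then 3 * A (from + (i - (to + 2 * len)))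
     else A i)"

lemma copied_Suc:
  assumes "from + len \<le> to" "k < len"
  shows "copied A from to len (Suc k) = (copied A from to len k)
    (to + k := A (from + k), to + len + k := A (from + k), to + 2 * len + k := 3 * A (from + k))"
proof
  fix i
  show "copied A from to len (Suc k) i = ((copied A from to len k)
    (to + k := A (from + k), to + len + k := A (from + k), to + 2 * len + k := 3 * A (from + k))) i"
  proof (cases "i = to + k \<or> i = to + len + k \<or> i = to + 2 * len + k")
    case True
    then show ?thesis using assms by (auto simp: copied_def)
  next
    case False
    then show ?thesis using assms by (auto simp: copied_def)
  qed
qed

lemma copy_block:
  assumes "nreg s 9 = 0" and le: "nreg s 6 + nreg s 2 \<le> nreg s 7"
  shows "halts copy_block (nreg s 2 * 5 + 1) s (\<lambda>s'. s' = s\<lparr>nreg := (nreg s)(9 := nreg s 2),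
    narr := (narr s)(2 := copied (narr s 2) (nreg s 6) (nreg s 7) (nreg s 2) (nreg s 2))\<rparr>)"
proof -
  define S where "S j = s\<lparr>nreg := (nreg s)(9 := j),
    narr := (narr s)(2 := copied (narr s 2) (nreg s 6) (nreg s 7) (nreg s 2) j)\<rparr>" for j
  let ?body = "NStore 2 (NPlus (NReg 7) (NReg 9)) (NArr 2 (NPlus (NReg 6) (NReg 9))) ;;
       NStore 2 (NPlus (NPlus (NReg 7) (NReg 2)) (NReg 9)) (NArr 2 (NPlus (NReg 6) (NReg 9))) ;;
       NStore 2 (NPlus (NPlus (NReg 7) (NPlus (NReg 2) (NReg 2))) (NReg 9))
         (NPlus (NArr 2 (NPlus (NReg 6) (NReg 9)))
           (NPlus (NArr 2 (NPlus (NReg 6) (NReg 9))) (NArr 2 (NPlus (NReg 6) (NReg 9))))) ;;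
       NAssign 9 (NPlus (NReg 9) (NLit 1))"
  \<comment> \<open>All targets lie behind the source block, so the cell to be read still has its
    original content.\<close>
  have src: "copied (narr s 2) (nreg s 6) (nreg s 7) (nreg s 2) j (nreg s 6 + j) = narr s 2 (nreg s 6 + j)"
    if "j < nreg s 2" for j
    using le that by (simp add: copied_def)
  have three: "k + (k + k) = 3 * k" for k :: nat by simp
  have step: "halts ?body 4 (S j) (\<lambda>s'. s' = S (Suc j))" if "j < nreg s 2" for j
    apply (rule halts_time, (rule halts_rules)+)
     apply (rule state.equality)
    using that le src[OF that] by (simp_all add: S_def copied_Suc mult_2 add.assoc three)
  have 0: "s = S 0" using assms by (cases s) (auto simp: S_def fun_eq_iff copied_def)
  have "halts copy_block (nreg s 2 * Suc 4 + 1) s (\<lambda>s'. s' = S (nreg s 2))"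
    unfolding copy_block_def
  proof (rule halts_While[where I = "\<lambda>t. \<exists>j\<le>nreg s 2. t = S j" and V = "\<lambda>t. nreg s 2 - nreg t 9"])
    fix t assume t: "\<exists>j\<le>nreg s 2. t = S j" "holds (NLess (NReg 9) (NReg 2)) t"
    then obtain j where j: "t = S j" "j < nreg s 2" by (auto simp: S_def)
    show "halts ?body 4 t (\<lambda>s'. (\<exists>j\<le>nreg s 2. s' = S j) \<and> nreg s 2 - nreg s' 9 < nreg s 2 - nreg t 9)"
      using j by (intro halts_mono[OF step[OF j(2), folded j(1)]]) (auto simp: S_def intro!: exI[of _ "Suc j"])
  next
    show "\<exists>j\<le>nreg s 2. s = S j" using 0 by blast
  next
    fix t assume "\<exists>j\<le>nreg s 2. t = S j" "\<not> holds (NLess (NReg 9) (NReg 2)) t"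
    then show "t = S (nreg s 2)" by (auto simp: S_def)
  qed simp
  then show ?thesis by (simp add: S_def)
qed

section \<open>Budget, roots, and the creation of children\<close>

context numbered_graph
begin

definition input_regs :: "state \<Rightarrow> bool" where
  "input_regs s \<longleftrightarrow> nreg s 0 = n \<and> nreg s 1 = m \<and> creg s 1 = q \<and> creg s 2 = w \<and>
     narr s 0 = x \<and> narr s 1 = y"

text \<open>The loop test is true for every \<open>b < B\<close> and false at \<open>B\<close>, so
  the halving stops at the least sufficient budget.\<close>

lemma choose_budget:
  assumes s: "nreg s 0 = n" "nreg s 3 = 0" "creg s 0 = of_real \<epsilon>"
    and B: "real c * real n * (1 / 2) ^ B \<le> min 1 \<epsilon>"
      "\<And>b. b < B \<Longrightarrow> min 1 \<epsilon> < real c * real n * (1 / 2) ^ b"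
  shows "halts (choose_budget c) (B * 3 + 4) s (\<lambda>s'. \<exists>z0 z3. s' = s\<lparr>nreg := (nreg s)(3 := B),
    creg := (creg s)(0 := z0, 3 := z3)\<rparr>)"
proof -
  define S where "S b = s\<lparr>nreg := (nreg s)(3 := b), creg := (creg s)(0 := of_real (min 1 \<epsilon>),
    3 := of_real (real c * real n * (1 / 2) ^ b))\<rparr>" for b
  let ?body = "CAssign 3 (CDivide (CReg 3) (COfNat (NLit 2))) ;; NAssign 3 (NPlus (NReg 3) (NLit 1))"
  have step: "halts ?body 2 (S b) (\<lambda>s'. s' = S (Suc b))" for b
    by (rule halts_time, (rule halts_rules)+) (simp_all add: S_def)
  have loop: "halts (While (ReLess (CReg 0) (CReg 3)) ?body) (B * Suc 2 + 1) (S 0) (\<lambda>s'. s' = S B)"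
  proof (rule halts_While[where I = "\<lambda>t. \<exists>b\<le>B. t = S b" and V = "\<lambda>t. B - nreg t 3"])
    fix t assume "\<exists>b\<le>B. t = S b" "holds (ReLess (CReg 0) (CReg 3)) t"
    then obtain b where b: "t = S b" "b < B" using B(1)
      by (auto simp: S_def le_less)
    show "halts ?body 2 t (\<lambda>s'. (\<exists>b\<le>B. s' = S b) \<and> B - nreg s' 3 < B - nreg t 3)"
      using b by (intro halts_mono[OF step[of b, folded b(1)]]) (auto simp: S_def intro!: exI[of _ "Suc b"])
  next
    fix t assume "\<exists>b\<le>B. t = S b" "\<not> holds (ReLess (CReg 0) (CReg 3)) t"
    then obtain b where b: "t = S b" "b \<le> B" "\<not> min 1 \<epsilon> < real c * real n * (1 / 2) ^ b"
      by (auto simp: S_def)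
    then show "t = S B" using B(2)[of b] by (cases "b = B") auto
  qed (auto simp: S_def)
  have 1: "halts (Cond (ReLess (COfNat (NLit 1)) (CReg 0)) (CAssign 0 (COfNat (NLit 1))) Skip) (Suc 1) s
    (\<lambda>s'. s' = s\<lparr>creg := (creg s)(0 := of_real (min 1 \<epsilon>))\<rparr>)"
  proof (rule halts_Cond)
    assume "\<not> holds (ReLess (COfNat (NLit 1)) (CReg 0)) s"
    then have "creg s 0 = of_real (min 1 \<epsilon>)" using s(3) by simp
    then have "s = s\<lparr>creg := (creg s)(0 := of_real (min 1 \<epsilon>))\<rparr>"
      by (cases s) (auto simp: fun_eq_iff)
    then show "halts Skip 1 s (\<lambda>s'. s' = s\<lparr>creg := (creg s)(0 := of_real (min 1 \<epsilon>))\<rparr>)"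
      by (rule halts_Skip)
  next
    assume "holds (ReLess (COfNat (NLit 1)) (CReg 0)) s"
    then show "halts (CAssign 0 (COfNat (NLit 1))) 1 s (\<lambda>s'. s' = s\<lparr>creg := (creg s)(0 := of_real (min 1 \<epsilon>))\<rparr>)"
      using s(3) by (intro halts_CAssign) simp
  qed
  have "halts (choose_budget c) (Suc 1 + (1 + (B * Suc 2 + 1))) s (\<lambda>s'. s' = S B)"
    unfolding choose_budget_def
  proof (rule halts_Seq[OF 1], hypsubst, rule halts_Seq_wp, rule halts_CAssign)
    have "(s\<lparr>creg := (creg s)(0 := of_real (min 1 \<epsilon>))\<rparr>)
      \<lparr>creg := (creg (s\<lparr>creg := (creg s)(0 := of_real (min 1 \<epsilon>))\<rparr>))
        (3 := cval (CTimes (COfNat (NLit c)) (COfNat (NReg 0))) (s\<lparr>creg := (creg s)(0 := of_real (min 1 \<epsilon>))\<rparr>))\<rparr> = S 0"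
      using s(1,2) by (cases s) (auto simp: S_def fun_eq_iff)
    then show "halts (While (ReLess (CReg 0) (CReg 3)) ?body) (B * Suc 2 + 1)
      ((s\<lparr>creg := (creg s)(0 := of_real (min 1 \<epsilon>))\<rparr>)
      \<lparr>creg := (creg (s\<lparr>creg := (creg s)(0 := of_real (min 1 \<epsilon>))\<rparr>))
        (3 := cval (CTimes (COfNat (NLit c)) (COfNat (NReg 0))) (s\<lparr>creg := (creg s)(0 := of_real (min 1 \<epsilon>))\<rparr>))\<rparr>)
      (\<lambda>s'. s' = S B)"
      using loop by simp
  qed
  then show ?thesis by (rule halts_mono) (auto simp: S_def)
qed

definition roots_inv :: "nat \<Rightarrow> state \<Rightarrow> bool" where
  "roots_inv b s \<longleftrightarrow> input_regs s \<and> nreg s 2 = L \<and> nreg s 3 = b \<and> nreg s 4 = 0 \<and> nreg s 6 = 0 \<and>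
     nreg s 5 \<le> n \<and> nreg s 7 = nreg s 5 * L \<and> narr s 4 = (\<lambda>_. 0) \<and>
     (\<forall>i<nreg s 5. \<forall>j<L. block (narr s 2) i j = root i j) \<and> (\<forall>i\<ge>nreg s 5 * L. narr s 2 i = 0) \<and>
     (\<forall>i<nreg s 5. narr s 3 i = b)"

lemma place_roots:
  assumes "input_regs s" "nreg s 3 = b" "nreg s 4 = 0" "nreg s 5 = 0" "nreg s 6 = 0" "nreg s 7 = 0"
    and "narr s 2 = (\<lambda>_. 0)" "narr s 4 = (\<lambda>_. 0)"
  shows "halts place_roots (n * (3 * n + 7) + 2) s (\<lambda>s'. roots_inv b s' \<and> nreg s' 5 = n)"
proof -
  let ?body = "NAssign 9 (NLit 0) ;; fill_removed ;;
       NStore 2 (NPlus (NReg 7) (NReg 5)) (NLit 1) ;;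
       NStore 3 (NReg 5) (NReg 3) ;;
       NAssign 5 (NPlus (NReg 5) (NLit 1)) ;;
       NAssign 7 (NPlus (NReg 7) (NReg 2))"
  have "halts ?body (3 * n + 6) t (\<lambda>t'. roots_inv b t' \<and> n - nreg t' 5 < n - nreg t 5)"
    if I: "roots_inv b t" and c: "nreg t 5 < n" for t
  proof -
    have body: "halts ?body (1 + ((nreg t 5 * 3 + 1) + (1 + (1 + (1 + 1))))) t
       (\<lambda>t'. t' = t\<lparr>nreg := (nreg t)(9 := nreg t 5, 5 := nreg t 5 + 1, 7 := nreg t 7 + nreg t 2),
         narr := (narr t)(2 := (\<lambda>i. if nreg t 7 \<le> i \<and> i < nreg t 7 + nreg t 5 then 3 else narr t 2 i)
             (nreg t 7 + nreg t 5 := 1),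
           3 := (narr t 3)(nreg t 5 := nreg t 3))\<rparr>)"
      apply (rule halts_time, rule halts_Seq_wp, rule halts_NAssign, rule halts_Seq[OF fill_removed])
        apply simp
       apply hypsubst
       apply (rule halts_rules)+
       apply (rule state.equality)
           apply (simp_all add: fun_upd_twist cong: if_cong)
      done
    show ?thesis
    proof (rule halts_mono[OF body])
      fix t' assume t': "t' = t\<lparr>nreg := (nreg t)(9 := nreg t 5, 5 := nreg t 5 + 1, 7 := nreg t 7 + nreg t 2),
         narr := (narr t)(2 := (\<lambda>i. if nreg t 7 \<le> i \<and> i < nreg t 7 + nreg t 5 then 3 else narr t 2 i)
             (nreg t 7 + nreg t 5 := 1),
           3 := (narr t 3)(nreg t 5 := nreg t 3))\<rparr>"
      let ?k = "nreg t 5"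
      note I' = I[unfolded roots_inv_def]
      have new: "block (narr t' 2) ?k j = root ?k j" if "j < L" for j
        using I' that by (auto simp: t' block_def root_def)
      have old: "block (narr t' 2) i j = root i j" if "i < ?k" "j < L" for i j
      proof -
        have "i * L + j < Suc i * L" using that by simp
        also have "\<dots> \<le> ?k * L" using that by (intro mult_le_mono1) simp
        finally have "block (narr t' 2) i j = block (narr t 2) i j"
          using I' by (simp add: t' block_def)
        then show ?thesis using I' that by simp
      qed
      show "roots_inv b t' \<and> n - nreg t' 5 < n - nreg t 5"
        unfolding roots_inv_def
      proof (intro conjI allI impI)
        show "block (narr t' 2) i j = root i j" if "i < nreg t' 5" "j < L" for i j
          using old new that by (auto simp: t' less_Suc_eq)
      qed (use I' c in \<open>auto simp: t' input_regs_def less_Suc_eq\<close>)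
    qed (use c in simp)
  qed
  then have loop: "halts (While (NLess (NReg 5) (NReg 0)) ?body) (n * Suc (3 * n + 6) + 1) t
      (\<lambda>s'. roots_inv b s' \<and> nreg s' 5 = n)" if "roots_inv b t" for t
    using that
    by (intro halts_While[where I = "roots_inv b" and V = "\<lambda>t. n - nreg t 5"])
      (auto simp: roots_inv_def input_regs_def)
  have "halts place_roots (1 + (n * Suc (3 * n + 6) + 1)) s (\<lambda>s'. roots_inv b s' \<and> nreg s' 5 = n)"
    unfolding place_roots_def using assms
    by (intro halts_Seq_wp halts_NAssign loop) (auto simp: roots_inv_def input_regs_def)
  then show ?thesis by (rule halts_time) simp
qed

lemma kind_exp:
  assumes "input_regs s" "nreg s 6 = cur * L"
  shows "nval kind_exp s = kind (block (narr s 2) cur) (nreg s 8)"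
  using assms by (simp add: kind_exp_def kind_def block_def input_regs_def)

definition active_at :: "(nat \<Rightarrow> nat) \<Rightarrow> nat \<Rightarrow> bool" where
  "active_at l e \<longleftrightarrow> 0 < kind l e \<and> kind l e < 3"

lemma scan_edges:
  assumes "input_regs s" "nreg s 6 = cur * L" "nreg s 8 = 0"
  shows "halts scan_edges (m * 2 + 1) s (\<lambda>s'. \<exists>e\<le>m. s' = s\<lparr>nreg := (nreg s)(8 := e)\<rparr> \<and>
    (if e < m then active_at (block (narr s 2) cur) e else \<forall>e<m. \<not> active_at (block (narr s 2) cur) e))"
proof -
  define S where "S e = s\<lparr>nreg := (nreg s)(8 := e)\<rparr>" for e
  let ?l = "block (narr s 2) cur"
  let ?b = "TAnd (NLess (NReg 8) (NReg 1)) (TNot (TAnd (NLess (NLit 0) kind_exp) (NLess kind_exp (NLit 3))))"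
  have test: "holds ?b (S e) \<longleftrightarrow> e < m \<and> \<not> active_at ?l e" for e
  proof -
    have "nval kind_exp (S e) = kind ?l e"
      using kind_exp[of "S e" cur] assms by (simp add: S_def input_regs_def)
    then show ?thesis using assms(1) by (auto simp: S_def active_at_def input_regs_def)
  qed
  have 0: "s = S 0" using assms(3) by (cases s) (auto simp: S_def fun_eq_iff)
  have "halts scan_edges (m * Suc 1 + 1) s (\<lambda>s'. \<exists>e\<le>m. s' = S e \<and>
      (if e < m then active_at ?l e else \<forall>e<m. \<not> active_at ?l e))"
    unfolding scan_edges_def
  proof (rule halts_While[where I = "\<lambda>t. \<exists>e\<le>m. t = S e \<and> (\<forall>i<e. \<not> active_at ?l i)" and V = "\<lambda>t. m - nreg t 8"])
    show "\<exists>e\<le>m. s = S e \<and> (\<forall>i<e. \<not> active_at ?l i)" using 0 by blast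
  next
    fix t assume t: "\<exists>e\<le>m. t = S e \<and> (\<forall>i<e. \<not> active_at ?l i)" "holds ?b t"
    then obtain e where e: "t = S e" "e < m" "\<forall>i<Suc e. \<not> active_at ?l i"
      using test by (auto simp: less_Suc_eq)
    have "halts (NAssign 8 (NPlus (NReg 8) (NLit 1))) 1 t (\<lambda>s'. s' = S (Suc e))"
      by (rule halts_NAssign) (simp add: e(1) S_def)
    then show "halts (NAssign 8 (NPlus (NReg 8) (NLit 1))) 1 t
        (\<lambda>s'. (\<exists>e\<le>m. s' = S e \<and> (\<forall>i<e. \<not> active_at ?l i)) \<and> m - nreg s' 8 < m - nreg t 8)"
    proof (rule halts_mono)
      fix s' assume s': "s' = S (Suc e)"
      then have "m - nreg s' 8 < m - nreg t 8" using e(2) by (simp add: e(1) S_def)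
      then show "(\<exists>e\<le>m. s' = S e \<and> (\<forall>i<e. \<not> active_at ?l i)) \<and> m - nreg s' 8 < m - nreg t 8"
        using s' e(2,3) Suc_leI by blast
    qed simp
  next
    fix t assume t: "\<exists>e\<le>m. t = S e \<and> (\<forall>i<e. \<not> active_at ?l i)" "\<not> holds ?b t"
    then obtain e where e: "e \<le> m" "t = S e" "\<forall>i<e. \<not> active_at ?l i" by blast
    then have "e < m \<longrightarrow> active_at ?l e" using t(2) test by blast
    with e show "\<exists>e\<le>m. t = S e \<and> (if e < m then active_at ?l e else \<forall>e<m. \<not> active_at ?l e)"
      by (intro exI[of _ e]) auto
  qed simp
  then show ?thesis by (rule halts_mono) (simp_all add: S_def)
qed

text \<open>Follows the order of the two stores: the second reads the array as the first one left
  it.\<close>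

definition patched :: "(nat \<Rightarrow> nat) \<Rightarrow> nat \<Rightarrow> nat \<Rightarrow> nat \<Rightarrow> nat \<Rightarrow> nat \<Rightarrow> nat" where
  "patched A from to len v =
    (let A' = A(to + len + v := 1)
     in A'(to + (len + len) + v := A' (to + (len + len) + v) + (1 - A' (from + v))))"

lemma patched_eq:
  assumes "from + len \<le> to" "v < len"
  shows "patched A from to len v =
    A(to + len + v := 1, to + 2 * len + v := A (to + 2 * len + v) + (1 - A (from + v)))"
  using assms by (auto simp: patched_def Let_def mult_2 fun_eq_iff)

lemma patch_end:
  assumes "a \<noteq> 2"
  shows "halts (patch_end a) 2 s (\<lambda>s'. s' = s\<lparr>narr := (narr s)
    (2 := patched (narr s 2) (nreg s 6) (nreg s 7) (nreg s 2) (narr s a (nreg s 8)))\<rparr>)"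
  unfolding patch_end_def
  by (rule halts_time, (rule halts_rules)+) (use assms in \<open>simp_all add: patched_def Let_def\<close>)

definition children_array :: "(nat \<Rightarrow> nat) \<Rightarrow> nat \<Rightarrow> nat \<Rightarrow> nat \<Rightarrow> nat \<Rightarrow> nat" where
  "children_array A cur cnt e =
    (let to = cnt * L; l = block A cur in
     patched (patched ((copied A (cur * L) to L L)(to + (n + e) := 3, to + L + (n + e) := 3))
       (cur * L) to L (x e)) (cur * L) to L (y e))"

lemma children_array_eq:
  assumes "cur < cnt" "e < m"
  shows "children_array A cur cnt e = (copied A (cur * L) (cnt * L) L L)
    (cnt * L + (n + e) := 3, cnt * L + L + (n + e) := 3,
     cnt * L + L + x e := 1, cnt * L + 2 * L + x e := 3 * block A cur (x e) + (1 - block A cur (x e)),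
     cnt * L + L + y e := 1, cnt * L + 2 * L + y e := 3 * block A cur (y e) + (1 - block A cur (y e)))"
proof -
  \<comment> \<open>Naming the products keeps the comparisons of addresses linear.\<close>
  define dst src len where "dst = cnt * L" and "src = cur * L" and "len = L"
  let ?C = "copied A src dst len len"
  have le: "src + len \<le> dst"
    using mult_le_mono1[of "Suc cur" cnt L] assms(1) by (simp add: dst_def src_def len_def)
  have b: "x e < len" "y e < len" "n + e < len" "x e \<noteq> y e"
    using assms(2) x_neq_y[OF assms(2)] by (auto simp: len_def trans_less_add1)
  have "?C (dst + 2 * len + j) = 3 * A (src + j)" "?C (src + j) = A (src + j)" if "j < len" for j
    using that le by (simp_all add: copied_def)
  then have C: "?C (dst + 2 * len + x e) = 3 * A (src + x e)" "?C (dst + 2 * len + y e) = 3 * A (src + y e)"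
    "?C (src + x e) = A (src + x e)" "?C (src + y e) = A (src + y e)"
    using b by auto
  have ne: "src + j \<noteq> dst + k" "src + j \<noteq> dst + len + k" "src + j \<noteq> dst + 2 * len + k"
    "dst + 2 * len + j \<noteq> dst + k'" "dst + 2 * len + j \<noteq> dst + len + k'" if "j < len" "k' < len" for j k k'
    using le that by linarith+
  have "patched (patched (?C(dst + (n + e) := 3, dst + len + (n + e) := 3)) src dst len (x e)) src dst len (y e) =
    ?C(dst + (n + e) := 3, dst + len + (n + e) := 3,
     dst + len + x e := 1, dst + 2 * len + x e := 3 * A (src + x e) + (1 - A (src + x e)),
     dst + len + y e := 1, dst + 2 * len + y e := 3 * A (src + y e) + (1 - A (src + y e)))"
    unfolding patched_eq[OF le b(1)] patched_eq[OF le b(2)] using C ne b by simp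
  then show ?thesis
    unfolding children_array_def Let_def block_def dst_def src_def len_def .
qed

lemma children_array:
  assumes "cur < cnt" "e < m"
  shows "i < cnt * L \<Longrightarrow> children_array A cur cnt e i = A i"
    and "j < L \<Longrightarrow> block (children_array A cur cnt e) cnt j = child1 (block A cur) e j"
    and "j < L \<Longrightarrow> block (children_array A cur cnt e) (cnt + 1) j = child2 (block A cur) e j"
    and "j < L \<Longrightarrow> block (children_array A cur cnt e) (cnt + 2) j = child3 (block A cur) e j"
proof -
  have b: "x e < n" "y e < n" "x e \<noteq> y e" using assms(2) x_neq_y by auto
  have nn: "m + (n + k) \<noteq> x e" "m + (n + k) \<noteq> y e" for k using b by linarith+
  have u: "(cnt + 1) * L = cnt * L + L" "(cnt + 2) * L = cnt * L + 2 * L" by (simp_all add: algebra_simps)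
  show "i < cnt * L \<Longrightarrow> children_array A cur cnt e i = A i"
    by (simp add: children_array_eq[OF assms] copied_def)
  show "block (children_array A cur cnt e) cnt j = child1 (block A cur) e j" if "j < L"
    using that b assms(2) unfolding block_def children_array_eq[OF assms] copied_def child1_def
    by (auto simp: block_def)
  show "block (children_array A cur cnt e) (cnt + 1) j = child2 (block A cur) e j" if "j < L"
    using that b nn assms(2) unfolding block_def u children_array_eq[OF assms] copied_def child2_def
    by (auto simp: block_def)
  show "block (children_array A cur cnt e) (cnt + 2) j = child3 (block A cur) e j" if "j < L"
    using that b nn assms(2) unfolding block_def u children_array_eq[OF assms] copied_def child3_def
    by (auto simp: block_def)
qed

lemma make_children:
  assumes s: "input_regs s" "nreg s 2 = L" "nreg s 4 = cur" "nreg s 5 = cnt"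
      "nreg s 6 = cur * L" "nreg s 7 = cnt * L" "nreg s 8 = e"
    and le: "cur < cnt" "e < m"
  shows "halts make_children (L * 5 + 15) s (\<lambda>s'. s' = s\<lparr>
    nreg := (nreg s)(9 := L, 5 := cnt + 3, 7 := (cnt + 3) * L),
    narr := (narr s)
      (2 := children_array (narr s 2) cur cnt e,
       3 := (narr s 3)(cnt := narr s 3 cur, cnt + 1 := narr s 3 cur - 1, cnt + 2 := narr s 3 cur - 1),
       4 := (narr s 4)(cur := cnt),
       5 := (narr s 5)(cur := kind (block (narr s 2) cur) e))\<rparr>)"
proof -
  let ?l = "block (narr s 2) cur"
  let ?C = "copied (narr s 2) (cur * L) (cnt * L) L L"
  \<comment> \<open>\<open>s1\<close> and \<open>s2\<close> are the states before and after copying,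
    \<open>s3\<close> is the final one.\<close>
  define s1 where "s1 = s\<lparr>narr := (narr s)(4 := (narr s 4)(cur := cnt), 5 := (narr s 5)(cur := kind ?l e)),
    nreg := (nreg s)(9 := 0)\<rparr>"
  define s2 where "s2 = s\<lparr>narr := (narr s)(2 := ?C, 4 := (narr s 4)(cur := cnt),
    5 := (narr s 5)(cur := kind ?l e)), nreg := (nreg s)(9 := L)\<rparr>"
  define s3 where "s3 = s\<lparr>
    nreg := (nreg s)(9 := L, 5 := cnt + 3, 7 := (cnt + 3) * L),
    narr := (narr s)
      (2 := children_array (narr s 2) cur cnt e,
       3 := (narr s 3)(cnt := narr s 3 cur, cnt + 1 := narr s 3 cur - 1, cnt + 2 := narr s 3 cur - 1),
       4 := (narr s 4)(cur := cnt),
       5 := (narr s 5)(cur := kind (block (narr s 2) cur) e))\<rparr>"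
  have len: "cur * L + L \<le> cnt * L"
    using mult_le_mono1[of "Suc cur" cnt L] le by simp
  have b: "x e < n" "y e < n" "x e \<noteq> y e" using le(2) x_neq_y by auto
  have kv: "nval kind_exp (s\<lparr>narr := (narr s)(4 := (narr s 4)(cur := cnt))\<rparr>) = kind ?l e"
    using kind_exp[of "s\<lparr>narr := (narr s)(4 := (narr s 4)(cur := cnt))\<rparr>" cur] s by (simp add: input_regs_def)
  have copy: "halts copy_block (L * 5 + 1) s1 (\<lambda>t. t = s2)"
  proof (rule halts_mono[OF copy_block])
    fix t assume "t = s1\<lparr>nreg := (nreg s1)(9 := nreg s1 2), narr := (narr s1)(2 :=
      copied (narr s1 2) (nreg s1 6) (nreg s1 7) (nreg s1 2) (nreg s1 2))\<rparr>"
    then show "t = s2"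
      using s by (auto simp: s1_def s2_def fun_upd_twist intro!: state.equality)
  qed (use s len in \<open>simp_all add: s1_def\<close>)
  have ri: "nreg s 0 = n" "narr s 0 = x" "narr s (Suc 0) = y"
    using s(1) by (simp_all add: input_regs_def)
  have cnt3: "(cnt + 3) * L = cnt * L + (L + (L + L))" by (simp add: add_mult_distrib)
  have rest: "halts (NStore 2 (NPlus (NReg 7) (NPlus (NReg 0) (NReg 8))) (NLit 3) ;;
    NStore 2 (NPlus (NPlus (NReg 7) (NReg 2)) (NPlus (NReg 0) (NReg 8))) (NLit 3) ;;
    patch_end 0 ;;
    patch_end 1 ;;
    NStore 3 (NReg 5) (NArr 3 (NReg 4)) ;;
    NStore 3 (NPlus (NReg 5) (NLit 1)) (NMinus (NArr 3 (NReg 4)) (NLit 1)) ;;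
    NStore 3 (NPlus (NReg 5) (NLit 2)) (NMinus (NArr 3 (NReg 4)) (NLit 1)) ;;
    NAssign 5 (NPlus (NReg 5) (NLit 3)) ;;
    NAssign 7 (NPlus (NReg 7) (NPlus (NReg 2) (NPlus (NReg 2) (NReg 2))))) 11 s2
    (\<lambda>s'. s' = s3)"
    unfolding s2_def
    apply (rule halts_time)
     apply (rule seq_NStore, simp add: s(2-) ri)
     apply (rule seq_NStore, simp add: s(2-) ri)
     apply (rule halts_Seq[OF patch_end], simp, hypsubst, simp add: s(2-) ri)
     apply (rule halts_Seq[OF patch_end], simp, hypsubst, simp add: s(2-) ri)
     apply (rule seq_NStore, simp add: s(2-) ri)
     apply (rule seq_NStore, simp add: s(2-) ri le(1)[THEN less_imp_neq])
     apply (rule seq_NStore, simp add: s(2-) ri le(1)[THEN less_imp_neq] le(1)[THEN less_SucI, THEN less_imp_neq])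
     apply (rule seq_NAssign, simp add: s(2-) ri)
     apply (rule halts_NAssign)
     apply (rule state.equality)
         apply (simp_all add: s(2-) ri s3_def children_array_def Let_def fun_upd_twist cnt3)
    done
  have "halts make_children (1 + (1 + (1 + ((L * 5 + 1) + 11)))) s (\<lambda>s'. s' = s3)"
    unfolding make_children_def
    apply (rule halts_time)
    apply (rule seq_NStore, simp add: s(2-) ri)
    apply (rule seq_NStore, simp add: s(2-) ri kv)
    apply (rule seq_NAssign, simp)
     apply (rule halts_Seq[OF copy[unfolded s1_def]], erule ssubst, rule rest[simplified])
    apply simp
    done
  then show ?thesis by (rule halts_mono) (simp_all add: s3_def)
qed

end

section \<open>Expansion, backward evaluation and the complete program\<close>

definition main_program :: "nat \<Rightarrow> com" where
  "main_program c = choose_budget c ;; place_roots ;; expand_all ;; evaluate_all ;; multiply_roots"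

context numbered_graph
begin

definition expand_inv :: "nat \<Rightarrow> nat \<Rightarrow> state \<Rightarrow> bool" where
  "expand_inv N b s \<longleftrightarrow> input_regs s \<and> nreg s 2 = L \<and> nreg s 6 = nreg s 4 * L \<and> nreg s 7 = nreg s 5 * L \<and>
     queue N b (narr s 2) (narr s 3) (narr s 4) (narr s 5) (nreg s 4) (nreg s 5)"

text \<open>Scanning costs at most \<open>2 * m + 1\<close> and copying \<open>5 * L + 1\<close>;
  with \<open>m \<le> L\<close> the sum stays below \<open>7 * L + 20\<close>.\<close>

lemma expand_step:
  assumes I: "expand_inv N b s" and less: "nreg s 4 < nreg s 5"
  shows "halts (NAssign 8 (NLit 0) ;;
       scan_edges ;;
       Cond (TAnd (NLess (NReg 8) (NReg 1)) (NLess (NLit 0) (NArr 3 (NReg 4)))) make_children Skip ;;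
       NAssign 4 (NPlus (NReg 4) (NLit 1)) ;;
       NAssign 6 (NPlus (NReg 6) (NReg 2))) (7 * L + 20) s
    (\<lambda>s'. expand_inv N b s' \<and> nreg s' 4 = Suc (nreg s 4))"
proof -
  let ?cur = "nreg s 4" and ?cnt = "nreg s 5" and ?l = "block (narr s 2) (nreg s 4)"
  define s0 where "s0 = s\<lparr>nreg := (nreg s)(8 := 0)\<rparr>"
  define S where "S e = s\<lparr>nreg := (nreg s)(8 := e)\<rparr>" for e
  note I' = I[unfolded expand_inv_def]
  have scan: "halts scan_edges (m * 2 + 1) s0 (\<lambda>s'. \<exists>e\<le>m. s' = S e \<and>
      (if e < m then active_at ?l e else \<forall>e<m. \<not> active_at ?l e))"
  proof -
    have "input_regs s0" "nreg s0 6 = ?cur * L" "nreg s0 8 = 0" using I' by (simp_all add: s0_def input_regs_def)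
    moreover have "s0\<lparr>nreg := (nreg s0)(8 := e)\<rparr> = S e" for e by (simp add: s0_def S_def)
    moreover have "narr s0 = narr s" by (simp add: s0_def)
    ultimately show ?thesis using scan_edges[of s0 ?cur] by (simp cong: if_cong split del: if_split)
  qed
  have adv: "halts (NAssign 4 (NPlus (NReg 4) (NLit 1)) ;; NAssign 6 (NPlus (NReg 6) (NReg 2))) 2 t
    (\<lambda>s'. s' = t\<lparr>nreg := (nreg t)(4 := nreg t 4 + 1, 6 := nreg t 6 + nreg t 2)\<rparr>)" for t
    by (rule halts_time, (rule halts_rules)+) simp_all
  have main: "halts (Cond (TAnd (NLess (NReg 8) (NReg 1)) (NLess (NLit 0) (NArr 3 (NReg 4)))) make_children Skip ;;
       NAssign 4 (NPlus (NReg 4) (NLit 1)) ;;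
       NAssign 6 (NPlus (NReg 6) (NReg 2))) (Suc (L * 5 + 15) + 2) (S e)
      (\<lambda>s'. expand_inv N b s' \<and> nreg s' 4 = Suc ?cur)"
    if e: "e \<le> m" "if e < m then active_at ?l e else \<forall>e<m. \<not> active_at ?l e" for e
  \<comment> \<open>The intermediate assertion already speaks of \<open>Suc ?cur\<close>, although
    registers 4 and 6 are advanced only afterwards.\<close>
  proof (rule halts_Seq[where P = "\<lambda>t. input_regs t \<and> nreg t 2 = L \<and> nreg t 4 = ?cur \<and> nreg t 6 = ?cur * L \<and>
      nreg t 7 = nreg t 5 * L \<and>
      queue N b (narr t 2) (narr t 3) (narr t 4) (narr t 5) (Suc ?cur) (nreg t 5)"], rule halts_Cond)
    assume "holds (TAnd (NLess (NReg 8) (NReg 1)) (NLess (NLit 0) (NArr 3 (NReg 4)))) (S e)"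
    then have e': "e < m" "0 < narr s 3 ?cur"
      using I' by (auto simp: S_def input_regs_def)
    have k: "0 < kind ?l e" "kind ?l e < 3" using e e'(1) by (auto simp: active_at_def)
    have Q: "queue N b (children_array (narr s 2) ?cur ?cnt e)
        ((narr s 3)(?cnt := narr s 3 ?cur, ?cnt + 1 := narr s 3 ?cur - 1, ?cnt + 2 := narr s 3 ?cur - 1))
        ((narr s 4)(?cur := ?cnt)) ((narr s 5)(?cur := kind ?l e)) (Suc ?cur) (?cnt + 3)"
    proof (rule queue_expand[of N b "narr s 2" "narr s 3" "narr s 4" "narr s 5" ?cur ?cnt e, OF _ less e'(1) k e'(2)])
      show "queue N b (narr s 2) (narr s 3) (narr s 4) (narr s 5) ?cur ?cnt" using I' by blast
    qed (fact children_array[OF less e'(1)] refl)+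
    show "halts make_children (L * 5 + 15) (S e) (\<lambda>t. input_regs t \<and> nreg t 2 = L \<and> nreg t 4 = ?cur \<and>
      nreg t 6 = ?cur * L \<and> nreg t 7 = nreg t 5 * L \<and>
      queue N b (narr t 2) (narr t 3) (narr t 4) (narr t 5) (Suc ?cur) (nreg t 5))"
      by (rule halts_mono[OF make_children[of "S e" ?cur ?cnt e]])
        (use I' Q less e'(1) in \<open>simp_all add: S_def input_regs_def\<close>)
  next
    assume "\<not> holds (TAnd (NLess (NReg 8) (NReg 1)) (NLess (NLit 0) (NArr 3 (NReg 4)))) (S e)"
    then have "\<not> e < m \<or> narr s 3 ?cur = 0"
      using I' by (auto simp: S_def input_regs_def)
    then have "narr s 3 ?cur = 0 \<or> (\<forall>e<m. \<not> (0 < kind ?l e \<and> kind ?l e < 3))"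
      using e(2) unfolding active_at_def by presburger
    then have "queue N b (narr s 2) (narr s 3) (narr s 4) (narr s 5) (Suc ?cur) ?cnt"
      using I' less by (intro queue_leaf) simp_all
    then show "halts Skip (L * 5 + 15) (S e) (\<lambda>t. input_regs t \<and> nreg t 2 = L \<and> nreg t 4 = ?cur \<and>
      nreg t 6 = ?cur * L \<and> nreg t 7 = nreg t 5 * L \<and>
      queue N b (narr t 2) (narr t 3) (narr t 4) (narr t 5) (Suc ?cur) (nreg t 5))"
      using I' by (intro halts_time[OF halts_Skip]) (simp_all add: S_def input_regs_def)
  next
    fix t assume t: "input_regs t \<and> nreg t 2 = L \<and> nreg t 4 = ?cur \<and> nreg t 6 = ?cur * L \<and>
      nreg t 7 = nreg t 5 * L \<and>
      queue N b (narr t 2) (narr t 3) (narr t 4) (narr t 5) (Suc ?cur) (nreg t 5)"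
    show "halts (NAssign 4 (NPlus (NReg 4) (NLit 1)) ;; NAssign 6 (NPlus (NReg 6) (NReg 2))) 2 t
      (\<lambda>s'. expand_inv N b s' \<and> nreg s' 4 = Suc ?cur)"
      by (rule halts_mono[OF adv]) (use t in \<open>simp_all add: expand_inv_def input_regs_def\<close>)
  qed
  show ?thesis
    apply (rule halts_time, rule seq_NAssign, unfold nval.simps, fold s0_def)
     apply (rule halts_Seq[OF scan])
     apply (elim exE conjE, erule ssubst, rule main, assumption+)
    apply simp
    done
qed

text \<open>The queue grows while it is processed, but its length never exceeds \<open>N\<close>, so
  \<open>N\<close> minus the current node is a valid variant.\<close>

lemma expand_all:
  assumes "expand_inv N b s"
  shows "halts expand_all (N * (7 * L + 21) + 1) s (\<lambda>s'. expand_inv N b s' \<and> nreg s' 4 = nreg s' 5)"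
proof -
  have le: "nreg t 5 \<le> N" if "expand_inv N b t" for t
    using that queue_cnt_le unfolding expand_inv_def by blast
  have "halts expand_all (N * Suc (7 * L + 20) + 1) s (\<lambda>s'. expand_inv N b s' \<and> nreg s' 4 = nreg s' 5)"
    unfolding expand_all_def
  proof (rule halts_While[where I = "expand_inv N b" and V = "\<lambda>t. N - nreg t 4"])
    fix t assume t: "expand_inv N b t" "holds (NLess (NReg 4) (NReg 5)) t"
    then have less: "nreg t 4 < nreg t 5" by simp
    show "halts (NAssign 8 (NLit 0) ;;
       scan_edges ;;
       Cond (TAnd (NLess (NReg 8) (NReg 1)) (NLess (NLit 0) (NArr 3 (NReg 4)))) make_children Skip ;;
       NAssign 4 (NPlus (NReg 4) (NLit 1)) ;;
       NAssign 6 (NPlus (NReg 6) (NReg 2))) (7 * L + 20) t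
      (\<lambda>s'. expand_inv N b s' \<and> N - nreg s' 4 < N - nreg t 4)"
      by (rule halts_mono[OF expand_step[OF t(1) less]]) (use less le[OF t(1)] in auto)
  next
    fix t assume "expand_inv N b t" "\<not> holds (NLess (NReg 4) (NReg 5)) t"
    then show "expand_inv N b t \<and> nreg t 4 = nreg t 5"
      by (auto simp: expand_inv_def queue_def)
  qed (use assms in auto)
  then show ?thesis by (rule halts_time) simp
qed

definition eval_inv :: "nat \<Rightarrow> nat \<Rightarrow> state \<Rightarrow> bool" where
  "eval_inv N b s \<longleftrightarrow> input_regs s \<and> nreg s 4 \<le> nreg s 5 \<and>
     queue N b (narr s 2) (narr s 3) (narr s 4) (narr s 5) (nreg s 5) (nreg s 5) \<and>
     valued (narr s 2) (narr s 3) (nreg s 5) (nreg s 4) (carr s 0)"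

lemma evaluate_step:
  assumes I: "eval_inv N b s" and pos: "0 < nreg s 4"
  shows "halts (NAssign 4 (NMinus (NReg 4) (NLit 1)) ;;
       Cond (NLess (NLit 0) (NArr 4 (NReg 4)))
         (Cond (NLess (NArr 5 (NReg 4)) (NLit 2))
           (CStore 0 (NReg 4)
             (CPlus (CArr 0 (NArr 4 (NReg 4)))
               (CDivide (CTimes (CDivide (CReg 2) (CReg 1)) (CArr 0 (NPlus (NArr 4 (NReg 4)) (NLit 1))))
                 (CArr 0 (NPlus (NArr 4 (NReg 4)) (NLit 2))))))
           (CStore 0 (NReg 4)
             (CTimes (CPlus (COfNat (NLit 1)) (CReg 2)) (CArr 0 (NArr 4 (NReg 4))))))
         (CStore 0 (NReg 4) (COfNat (NLit 1)))) 4 s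
    (\<lambda>s'. eval_inv N b s' \<and> nreg s' 4 < nreg s 4)"
proof -
  define i where "i = nreg s 4 - 1"
  have i: "nreg s 4 = Suc i" using pos by (simp add: i_def)
  note I' = I[unfolded eval_inv_def i]
  define v where "v = carr s 0"
  define z where "z = (if narr s 4 i = 0 then 1 else combine (narr s 5 i) (v (narr s 4 i)) (v (narr s 4 i + 1)) (v (narr s 4 i + 2)))"
  define s' where "s' = s\<lparr>nreg := (nreg s)(4 := i), carr := (carr s)(0 := v(i := z))\<rparr>"
  have "valued (narr s 2) (narr s 3) (nreg s 5) i (v(i := z))"
    using I' by (intro valued_step[of N b _ _ "narr s 4" "narr s 5"]) (auto simp: z_def v_def)
  then have "eval_inv N b s' \<and> nreg s' 4 < nreg s 4"
    using I' by (auto simp: eval_inv_def s'_def i input_regs_def)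
  moreover have "halts (NAssign 4 (NMinus (NReg 4) (NLit 1)) ;;
       Cond (NLess (NLit 0) (NArr 4 (NReg 4)))
         (Cond (NLess (NArr 5 (NReg 4)) (NLit 2))
           (CStore 0 (NReg 4)
             (CPlus (CArr 0 (NArr 4 (NReg 4)))
               (CDivide (CTimes (CDivide (CReg 2) (CReg 1)) (CArr 0 (NPlus (NArr 4 (NReg 4)) (NLit 1))))
                 (CArr 0 (NPlus (NArr 4 (NReg 4)) (NLit 2))))))
           (CStore 0 (NReg 4)
             (CTimes (CPlus (COfNat (NLit 1)) (CReg 2)) (CArr 0 (NArr 4 (NReg 4))))))
         (CStore 0 (NReg 4) (COfNat (NLit 1)))) (1 + Suc (Suc 1)) s
    (\<lambda>t. t = s')"
    using I' i
    by (intro halts_Seq_wp halts_NAssign halts_Cond halts_time[OF halts_CStore];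
        (rule state.equality)?) (auto simp: s'_def z_def v_def combine_def input_regs_def)
  ultimately show ?thesis by (elim halts_mono) auto
qed

lemma evaluate_all:
  assumes "eval_inv N b s"
  shows "halts evaluate_all (N * 5 + 1) s (\<lambda>s'. eval_inv N b s' \<and> nreg s' 4 = 0)"
proof -
  have "nreg s 4 \<le> N"
    using assms queue_cnt_le unfolding eval_inv_def by (blast intro: order_trans)
  then have "halts evaluate_all (N * Suc 4 + 1) s (\<lambda>s'. eval_inv N b s' \<and> nreg s' 4 = 0)"
    unfolding evaluate_all_def
    by (intro halts_While[where I = "eval_inv N b" and V = "\<lambda>t. nreg t 4"] evaluate_step assms) simp_all
  then show ?thesis by simp
qed

text \<open>The roots are the first \<open>n\<close> nodes, and register 4, back at 0, is reused as
  the counter.\<close>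

lemma multiply_roots:
  assumes "input_regs s" "nreg s 4 = 0"
  shows "halts multiply_roots (n * 3 + 2) s (\<lambda>s'. creg s' 0 = q ^ n * (\<Prod>i<n. carr s 0 i))"
proof -
  define I where "I t \<longleftrightarrow> nreg t 4 \<le> n \<and> nreg t 0 = n \<and> creg t 1 = q \<and> carr t 0 = carr s 0 \<and>
    creg t 0 = q ^ nreg t 4 * (\<Prod>i<nreg t 4. carr s 0 i)" for t :: state
  have "halts (CAssign 0 (CTimes (CTimes (CReg 0) (CReg 1)) (CArr 0 (NReg 4))) ;;
      NAssign 4 (NPlus (NReg 4) (NLit 1))) 2 t (\<lambda>t'. I t' \<and> n - nreg t' 4 < n - nreg t 4)"
    if "I t" "holds (NLess (NReg 4) (NReg 0)) t" for t
    by (rule halts_time, (rule halts_rules)+) (use that in \<open>auto simp: I_def\<close>)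
  then have loop: "halts (While (NLess (NReg 4) (NReg 0))
      (CAssign 0 (CTimes (CTimes (CReg 0) (CReg 1)) (CArr 0 (NReg 4))) ;;
      NAssign 4 (NPlus (NReg 4) (NLit 1)))) (n * Suc 2 + 1) t
      (\<lambda>s'. creg s' 0 = q ^ n * (\<Prod>i<n. carr s 0 i))" if "I t" for t
    using that by (intro halts_While[where I = I and V = "\<lambda>t. n - nreg t 4"]) (auto simp: I_def)
  show ?thesis
    unfolding multiply_roots_def
    by (rule halts_time, rule halts_Seq_wp, rule halts_CAssign, rule loop)
      (use assms in \<open>auto simp: I_def input_regs_def\<close>)
qed

lemma main_program:
  assumes s: "input_regs s" "nreg s 3 = 0" "nreg s 4 = 0" "nreg s 5 = 0" "nreg s 6 = 0" "nreg s 7 = 0"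
      "creg s 0 = of_real \<epsilon>" "narr s 2 = (\<lambda>_. 0)" "narr s 4 = (\<lambda>_. 0)"
    and c: "32 * M ^ \<Delta> \<le> real c"
    and B: "real c * real n * (1 / 2) ^ B \<le> min 1 \<epsilon>"
      "\<And>b. b < B \<Longrightarrow> min 1 \<epsilon> < real c * real n * (1 / 2) ^ b"
    and N: "N = n * 2 ^ (\<Delta> + (\<Delta> + 2) * B)"
  shows "halts (main_program c)
    ((B * 3 + 4) + ((n * (3 * n + 7) + 2) + ((N * (7 * L + 21) + 1) + ((N * 5 + 1) + (n * 3 + 2))))) s
    (\<lambda>s'. mult_approx \<epsilon> (final_value s') (Z_T G q w))"
  unfolding main_program_def
proof (rule halts_Seq[OF choose_budget[OF _ s(2,7) B]])
  show "nreg s 0 = n" using s(1) by (simp add: input_regs_def)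
next
  fix s1 assume "\<exists>z0 z3. s1 = s\<lparr>nreg := (nreg s)(3 := B), creg := (creg s)(0 := z0, 3 := z3)\<rparr>"
  then have s1: "input_regs s1" "nreg s1 3 = B" "nreg s1 4 = 0" "nreg s1 5 = 0" "nreg s1 6 = 0" "nreg s1 7 = 0"
    "narr s1 2 = (\<lambda>_. 0)" "narr s1 4 = (\<lambda>_. 0)"
    using s by (auto simp: input_regs_def)
  show "halts (place_roots ;; expand_all ;; evaluate_all ;; multiply_roots)
    ((n * (3 * n + 7) + 2) + ((N * (7 * L + 21) + 1) + ((N * 5 + 1) + (n * 3 + 2)))) s1
    (\<lambda>s'. mult_approx \<epsilon> (final_value s') (Z_T G q w))"
  proof (rule halts_Seq[OF place_roots[OF s1]])
    fix s2 assume s2: "roots_inv B s2 \<and> nreg s2 5 = n"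
    have "queue N B (narr s2 2) (narr s2 3) (narr s2 4) (narr s2 5) 0 n"
      using queue_init[of "narr s2 2" "narr s2 3" B "narr s2 5"] s2 by (simp add: roots_inv_def N)
    then have "expand_inv N B s2" using s2 by (simp add: roots_inv_def expand_inv_def)
    then show "halts (expand_all ;; evaluate_all ;; multiply_roots)
      ((N * (7 * L + 21) + 1) + ((N * 5 + 1) + (n * 3 + 2))) s2
      (\<lambda>s'. mult_approx \<epsilon> (final_value s') (Z_T G q w))"
    proof (rule halts_Seq[OF expand_all])
      fix s3 assume "expand_inv N B s3 \<and> nreg s3 4 = nreg s3 5"
      \<comment> \<open>Evaluation starts at the end of the queue, where no node is required to have
        a value yet.\<close>
      then have "eval_inv N B s3" by (auto simp: expand_inv_def eval_inv_def valued_def)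
      then show "halts (evaluate_all ;; multiply_roots) ((N * 5 + 1) + (n * 3 + 2)) s3
        (\<lambda>s'. mult_approx \<epsilon> (final_value s') (Z_T G q w))"
      proof (rule halts_Seq[OF evaluate_all])
        fix s4 assume s4: "eval_inv N B s4 \<and> nreg s4 4 = 0"
        have "32 * real n * M ^ \<Delta> * (1 / 2) ^ B = (32 * M ^ \<Delta>) * (real n * (1 / 2) ^ B)" by simp
        also have "\<dots> \<le> real c * (real n * (1 / 2) ^ B)" using c by (intro mult_right_mono) auto
        finally have "32 * real n * M ^ \<Delta> * (1 / 2) ^ B \<le> min 1 \<epsilon>" using B(1) by simp
        then have "mult_approx \<epsilon> (q ^ n * (\<Prod>i<n. carr s4 0 i)) (Z_T G q w)"
          using s4 unfolding eval_inv_def by (intro queue_result) auto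
        then show "halts multiply_roots (n * 3 + 2) s4 (\<lambda>s'. mult_approx \<epsilon> (final_value s') (Z_T G q w))"
          using s4 by (intro halts_mono[OF multiply_roots]) (auto simp: eval_inv_def final_value_def)
      qed
    qed
  qed
qed

text \<open>Every edge is counted at some end. The block length is thereby linear in
  \<open>n\<close>.\<close>

lemma edges_le: "m \<le> \<Delta> * n"
proof -
  have "edges G \<subseteq> (\<Union>v\<in>verts G. {e \<in> edges G. v \<in> ends G e})"
  proof
    fix e assume e: "e \<in> edges G"
    then obtain j where "j < m" "e = g j" by (rule edge_cases)
    then have "f (x j) \<in> ends G e" "f (x j) \<in> verts G" using ends_g by auto
    then show "e \<in> (\<Union>v\<in>verts G. {e \<in> edges G. v \<in> ends G e})" using e by blast
  qed
  then have "card (edges G) \<le> card (\<Union>v\<in>verts G. {e \<in> edges G. v \<in> ends G e})"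
    using finite_verts finite_edges by (intro card_mono) auto
  also have "\<dots> \<le> (\<Sum>v\<in>verts G. card {e \<in> edges G. v \<in> ends G e})"
    by (rule card_UN_le[OF finite_verts])
  also have "\<dots> \<le> (\<Sum>v\<in>verts G. \<Delta>)"
    using degree by (intro sum_mono) (simp add: vertex_degree_def)
  finally show ?thesis
    using bij_betw_same_card[OF f] bij_betw_same_card[OF g] by (simp add: mult.commute)
qed

end

section \<open>Polynomial running time\<close>

text \<open>As \<open>2 ^ B\<close> is linear in \<sigma>, the number \<open>N\<close> of nodes has
  degree \<open>d + 3\<close> and its product with the block length degree \<open>d + 4\<close>. In
  \<open>E\<close>, the term \<open>6 * c\<close> comes from the budget, 23 from the constants and
  the terms in \<open>n\<close>, and \<open>7 * d + 33\<close> is 7 * (1 + d) + 26 from the terms in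
  \<open>N\<close>. The claim has one number as both factor and exponent, so \<open>E\<close> also
  enters the exponent.\<close>

lemma polynomial_time:
  fixes \<sigma> :: real and n B N l c d :: nat
  assumes \<sigma>: "1 \<le> \<sigma>" "real n \<le> \<sigma>" "2 ^ B \<le> 2 * real c * \<sigma>"
    and N: "N = n * 2 ^ (d + (d + 2) * B)" and l: "l \<le> n + d * n"
    and E: "E = 6 * c + 23 + 2 ^ d * (2 * c) ^ (d + 2) * (7 * d + 33)"
  shows "real ((B * 3 + 4) + ((n * (3 * n + 7) + 2) + ((N * (7 * l + 21) + 1) + ((N * 5 + 1) + (n * 3 + 2)))))
    \<le> real (E + d + 4) * \<sigma> ^ (E + d + 4)"
proof -
  let ?p = "\<sigma> ^ (d + 4)" and ?D = "2 ^ d * (2 * real c) ^ (d + 2)"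
  have p: "\<sigma> ^ k \<le> ?p" if "k \<le> d + 4" for k
    using that \<sigma>(1) by (intro power_increasing)
  have p1: "\<sigma> \<le> ?p" "1 \<le> ?p" "\<sigma> * \<sigma> \<le> ?p"
    using p[of 1] p[of 0] p[of 2] by (simp_all add: power2_eq_square)
  have "real B \<le> 2 ^ B" using of_nat_less_two_power[of B, where 'a = real] by simp
  also have "\<dots> \<le> 2 * real c * ?p"
    using \<sigma>(3) p1(1) by (intro order_trans[OF \<sigma>(3)] mult_left_mono) auto
  finally have B: "real B \<le> 2 * real c * ?p" .
  have n: "real n \<le> ?p" using \<sigma>(2) p1(1) by linarith
  have "real n * real n \<le> \<sigma> * \<sigma>" using \<sigma> by (intro mult_mono) auto
  then have nn: "real n * real n \<le> ?p" using p1(3) by linarith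
  have "real N = real n * (2 ^ d * (2 ^ B) ^ (d + 2))"
    by (simp add: N power_add power_mult mult.commute[of B] flip: power_mult)
  also have "\<dots> \<le> \<sigma> * (2 ^ d * (2 * real c * \<sigma>) ^ (d + 2))"
    using \<sigma> by (intro mult_mono power_mono) auto
  also have "\<dots> = ?D * \<sigma> ^ (d + 3)"
  proof -
    have "\<sigma> ^ (d + 3) = \<sigma> * \<sigma> ^ (d + 2)" by (simp add: numeral_3_eq_3)
    then show ?thesis by (simp only: power_mult_distrib mult_ac)
  qed
  finally have NN: "real N \<le> ?D * \<sigma> ^ (d + 3)" .
  have D0: "0 \<le> ?D" by simp
  have "real N * 26 \<le> ?D * \<sigma> ^ (d + 3) * 26" using NN by linarith
  also have "\<dots> \<le> ?D * ?p * 26"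
    using p[of "d + 3"] D0 by (intro mult_right_mono mult_left_mono) auto
  finally have N1: "real N * 26 \<le> ?D * ?p * 26" .
  have "real l \<le> real n + real d * real n"
    using l by (metis of_nat_add of_nat_le_iff of_nat_mult)
  also have "\<dots> \<le> (1 + real d) * \<sigma>"
    using mult_left_mono[OF \<sigma>(2), of "1 + real d"] by (simp add: algebra_simps)
  finally have l': "real l \<le> (1 + real d) * \<sigma>" .
  have "0 \<le> ?D * \<sigma> ^ (d + 3)" using NN by linarith
  from mult_mono[OF NN l' this of_nat_0_le_iff]
  have "real N * real l \<le> (?D * \<sigma> ^ (d + 3)) * ((1 + real d) * \<sigma>)" .
  also have "\<dots> = ?D * ?p * (1 + real d)" by (simp add: power_add numeral_eq_Suc algebra_simps)
  finally have N2: "real N * real l \<le> ?D * ?p * (1 + real d)" .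
  have "real ((B * 3 + 4) + ((n * (3 * n + 7) + 2) + ((N * (7 * l + 21) + 1) + ((N * 5 + 1) + (n * 3 + 2)))))
    = 3 * real B + 10 + 3 * (real n * real n) + 10 * real n + 7 * (real N * real l) + real N * 26"
    by (simp add: algebra_simps)
  also have "\<dots> \<le> 3 * (2 * real c * ?p) + 10 * ?p + 3 * ?p + 10 * ?p + 7 * (?D * ?p * (1 + real d)) + ?D * ?p * 26"
    using B p1(2) nn n N1 N2 by linarith
  also have "\<dots> = real E * ?p"
    by (simp add: E algebra_simps)
  also have "\<dots> \<le> real (E + d + 4) * \<sigma> ^ (E + d + 4)"
    using \<sigma>(1) by (intro mult_mono power_increasing) auto
  finally show ?thesis .
qed

theorem theorem1p3:
  fixes \<Delta> :: nat and w :: complex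
  shows "\<exists>K::real. \<forall>q::complex. cmod q > K \<longrightarrow>
    (\<exists>(alg::com) (C::nat).
      \<forall>(G :: (nat, nat) multigraph) (n::nat) (es :: (nat \<times> nat) list) (\<epsilon>::real).
        loopless_multigraph G \<longrightarrow> (\<forall>v\<in>verts G. vertex_degree G v \<le> \<Delta>) \<longrightarrow> presents n es G \<longrightarrow> \<epsilon> > 0 \<longrightarrow>
        (\<exists>t s. exec alg (input_state q w n es \<epsilon>) t s \<and>
           real t \<le> real C * size_over_eps G \<epsilon> ^ C \<and>
           mult_approx \<epsilon> (final_value s) (Z_T G q w)))"
proof -
  \<comment> \<open>Programs contain only natural literals, so \<open>32 * M ^ \<Delta>\<close> is
    rounded up.\<close>
  define c where "c = nat \<lceil>32 * (2 + cmod w) ^ \<Delta>\<rceil>"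
  define E where "E = 6 * c + 23 + 2 ^ \<Delta> * (2 * c) ^ (\<Delta> + 2) * (7 * \<Delta> + 33)"
  have c: "32 * (2 + cmod w) ^ \<Delta> \<le> real c" unfolding c_def by linarith
  have "1 \<le> (2 + cmod w) ^ \<Delta>" by (intro one_le_power) auto
  then have c1: "1 \<le> real c" using c by linarith
  \<comment> \<open>The bound on \<open>cmod q\<close> below is the constant \<open>K\<close>; the
    program depends on \<Delta> and \<open>w\<close> only, through \<open>c\<close>.\<close>
  have "\<exists>t s. exec (main_program c) (input_state q w n es \<epsilon>) t s \<and>
      real t \<le> real (E + \<Delta> + 4) * size_over_eps G \<epsilon> ^ (E + \<Delta> + 4) \<and>
      mult_approx \<epsilon> (final_value s) (Z_T G q w)"
    if q: "cmod q > 12 * (real \<Delta> + 1) * cmod w * (2 + cmod w) ^ (2 * \<Delta>)"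
      and G: "loopless_multigraph G" "\<forall>v\<in>verts G. vertex_degree G v \<le> \<Delta>"
      and pres: "presents n es G" and \<epsilon>: "\<epsilon> > 0"
    for q and G :: "(nat, nat) multigraph" and n es \<epsilon>
  proof -
    obtain f g where fg: "bij_betw f {..<n} (verts G)" "bij_betw g {..<length es} (edges G)"
      "\<forall>i<length es. fst (es ! i) < n \<and> snd (es ! i) < n \<and> ends G (g i) = {f (fst (es ! i)), f (snd (es ! i))}"
      using pres unfolding presents_def by blast
    \<comment> \<open>The default 0 beyond the list makes these functions equal to the input arrays
      at every index.\<close>
    interpret numbered_graph G \<Delta> q w n "length es"
      "\<lambda>i. if i < length es then fst (es ! i) else 0" "\<lambda>i. if i < length es then snd (es ! i) else 0" f g
      using q G fg by unfold_locales auto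
    let ?\<delta> = "min 1 \<epsilon>" and ?\<sigma> = "size_over_eps G \<epsilon>"
    have \<delta>: "0 < ?\<delta>" "?\<delta> \<le> 1" using \<epsilon> by auto
    have card: "card (verts G) = n" using bij_betw_same_card[OF fg(1)] by simp
    have \<sigma>n: "real n \<le> ?\<sigma> * ?\<delta>" using \<delta>(1) by (simp add: size_over_eps_def card)
    have \<sigma>1: "1 \<le> ?\<sigma>"
      using frac_le[of "max 1 (real n)" 1 ?\<delta> 1] \<delta> by (simp add: size_over_eps_def card le_divide_eq)
    have "?\<sigma> * ?\<delta> \<le> ?\<sigma> * 1" using \<delta> \<sigma>1 by (intro mult_left_mono) auto
    with \<sigma>n have \<sigma>n': "real n \<le> ?\<sigma>" by simp
    define P where "P b \<longleftrightarrow> real c * real n * (1 / 2) ^ b \<le> ?\<delta>" for b :: nat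
    obtain b0 where "P b0"
    proof -
      \<comment> \<open>Adding 1 keeps the denominator positive for the empty graph.\<close>
      obtain b0 where b0: "(1 / 2 :: real) ^ b0 < ?\<delta> / (real c * real n + 1)"
        using real_arch_pow_inv[of "?\<delta> / (real c * real n + 1)" "1 / 2"] \<delta>(1)
        by (auto simp: add_nonneg_pos)
      have "real c * real n * (1 / 2) ^ b0 \<le> (real c * real n + 1) * (1 / 2) ^ b0"
        by (intro mult_right_mono) auto
      also have "\<dots> \<le> ?\<delta>" using b0 by (simp add: less_divide_eq add_nonneg_pos mult.commute less_imp_le)
      finally show ?thesis using that by (simp add: P_def)
    qed
    define B where "B = (LEAST b. P b)"
    have PB: "P B" unfolding B_def using \<open>P b0\<close> by (rule LeastI)
    have nP: "\<not> P b" if "b < B" for b using that not_less_Least unfolding B_def by blast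
    \<comment> \<open>Minimality of \<open>B\<close>: the budget \<open>B - 1\<close> is
      insufficient, which bounds its power of 2 by \<open>c\<close> times the size
      parameter.\<close>
    have "2 ^ B \<le> 2 * real c * ?\<sigma>"
    proof (cases B)
      case 0
      have "1 * 1 \<le> real c * ?\<sigma>" using c1 \<sigma>1 by (intro mult_mono) auto
      then show ?thesis using 0 by simp
    next
      case (Suc b)
      have "?\<delta> < real c * real n * (1 / 2) ^ b" using nP[of b] Suc unfolding P_def by linarith
      then have "?\<delta> * 2 ^ b < real c * real n" by (simp add: power_one_over field_simps)
      also have "\<dots> \<le> real c * (?\<sigma> * ?\<delta>)" using \<sigma>n by (intro mult_left_mono) auto
      finally have "?\<delta> * 2 ^ b < ?\<delta> * (real c * ?\<sigma>)" by (simp add: mult_ac)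
      then have "2 ^ b < real c * ?\<sigma>" using \<delta>(1) by (simp only: mult_less_cancel_left_pos)
      then show ?thesis using Suc by simp
    qed
    note time = polynomial_time[OF \<sigma>1 \<sigma>n' this refl _ E_def, of "n + length es"]
    let ?s = "input_state q w n es \<epsilon>"
    have "halts (main_program c)
      ((B * 3 + 4) + ((n * (3 * n + 7) + 2) +
        ((n * 2 ^ (\<Delta> + (\<Delta> + 2) * B) * (7 * (n + length es) + 21) + 1) +
        ((n * 2 ^ (\<Delta> + (\<Delta> + 2) * B) * 5 + 1) + (n * 3 + 2))))) ?s
      (\<lambda>s'. mult_approx \<epsilon> (final_value s') (Z_T G q w))"
    proof (rule main_program[OF _ _ _ _ _ _ _ _ _ c _ _ refl])
      show "input_regs ?s" by (simp add: input_regs_def input_state_def)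
      show "real c * real n * (1 / 2) ^ B \<le> min 1 \<epsilon>" using PB by (simp add: P_def)
      show "min 1 \<epsilon> < real c * real n * (1 / 2) ^ b" if "b < B" for b
        using nP[OF that] unfolding P_def by linarith
    qed (simp_all add: input_state_def)
    then show ?thesis
      using time edges_le unfolding halts_def by (meson add_left_mono of_nat_le_iff order_trans)
  qed
  then show ?thesis by blast
qed

end
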